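(* Let $I\subset R=\Bbbk[x_0,\ldots,x_n]$ be a nonzero proper equigenerated monomial ideal with big-height $e$, let $\mathcal{Q}$ be its symbolic polyhedron and let $\mathfrak{m}=(x_0,\ldots,x_n)$. If $$\alpha(\mathcal{Q})\ \ge\ \frac{\alpha(I)+e-1}{e},$$ then $I^{(er)}\subseteq \mathfrak{m}^{(e-1)r} I^r$ for all positive integers $r$.
   Context: $\Bbbk$ is a field. An ideal is equigenerated if all of its minimal generators have the same degree. $\operatorname{Ass}(I)$ is the set of associated primes of $I$ (of $R/I$), and $\operatorname{maxAss}(I)$ is the subset of those maximal with respect to inclusion. The $m$-th symbolic power is $I^{(m)} = R\cap\bigcap_{P\in \operatorname{Ass}(I)} I^m R_P$. The big-height of $I$ is the maximum of the heights of its associated primes. For a nonzero homogeneous ideal $J$, $\alpha(J)$ is the least degree $d$ with $J_d\ne 0$. For $P\in\operatorname{maxAss}(I)$ put $Q_{\subseteq P}=R\cap I R_P$, a monomial ideal. For a monomial ideal $M$, $\mathcal{L}(M)=\{\mathbf{a}\in\mathbb{N}^{n+1}\mid \mathbf{x}^{\mathbf{a}}\in M\}$, where $\mathbb{N}$ is the set of non-negative integers and $\mathbf{x}^{\mathbf a}=x_0^{a_0}\cdots x_n^{a_n}$. The symbolic polyhedron of $I$ is $\mathcal{Q}=\bigcap_{P\in\operatorname{maxAss}(I)}\operatorname{conv}(\mathcal{L}(Q_{\subseteq P}))\subseteq\mathbb{R}^{n+1}$ ($\operatorname{conv}$ denotes convex hull), and $\alpha(\mathcal{Q})=\min\{a_0+\cdots+a_n\mid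 (a_0,\ldots,a_n)\in\mathcal{Q}\}$. *)

theory Defs
  imports
    "HOL-Analysis.Analysis"
    "HOL-Library.Poly_Mapping"
    "HOL-Library.Extended_Nat"
    "HOL-Algebra.Ideal_Product"
    "HOL-Algebra.Algebraic_Closure_Type"
begin

section \<open>Localisation at a prime\<close>

text \<open>
  Let \<open>P\<close> be a prime ideal of the commutative ring \<open>R\<close>. The elements of \<open>R\<^sub>P\<close> are the classes
  of pairs \<open>(a, s)\<close>, \<open>s \<notin> P\<close>, with \<open>(a, s) \<sim> (b, t)\<close> iff \<open>u (a t - b s) = 0\<close> for some \<open>u \<notin> P\<close>.
\<close>

definition frac_rel :: "('a, 'c) ring_scheme \<Rightarrow> 'a set \<Rightarrow> (('a \<times> 'a) \<times> ('a \<times> 'a)) set" where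
  "frac_rel R P =
     {((a, s), (b, t)) | a s b t.
        a \<in> carrier R \<and> b \<in> carrier R \<and> s \<in> carrier R - P \<and> t \<in> carrier R - P \<and>
        (\<exists>u \<in> carrier R - P. u \<otimes>\<^bsub>R\<^esub> (a \<otimes>\<^bsub>R\<^esub> t \<ominus>\<^bsub>R\<^esub> b \<otimes>\<^bsub>R\<^esub> s) = \<zero>\<^bsub>R\<^esub>)}"

definition loc_frac :: "('a, 'c) ring_scheme \<Rightarrow> 'a set \<Rightarrow> 'a \<Rightarrow> 'a \<Rightarrow> ('a \<times> 'a) set" where
  "loc_frac R P a s = frac_rel R P `` {(a, s)}"

definition localization :: "('a, 'c) ring_scheme \<Rightarrow> 'a set \<Rightarrow> ('a \<times> 'a) set ring" where
  "localization R P =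
     \<lparr> carrier = (carrier R \<times> (carrier R - P)) // frac_rel R P,
       monoid.mult = (\<lambda>A B. \<Union>(a, s) \<in> A. \<Union>(b, t) \<in> B. loc_frac R P (a \<otimes>\<^bsub>R\<^esub> b) (s \<otimes>\<^bsub>R\<^esub> t)),
       one = loc_frac R P \<one>\<^bsub>R\<^esub> \<one>\<^bsub>R\<^esub>,
       ring.zero = loc_frac R P \<zero>\<^bsub>R\<^esub> \<one>\<^bsub>R\<^esub>,
       add = (\<lambda>A B. \<Union>(a, s) \<in> A. \<Union>(b, t) \<in> B.
                loc_frac R P (a \<otimes>\<^bsub>R\<^esub> t \<oplus>\<^bsub>R\<^esub> b \<otimes>\<^bsub>R\<^esub> s) (s \<otimes>\<^bsub>R\<^esub> t)) \<rparr>"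

definition ext_ideal :: "('a, 'c) ring_scheme \<Rightarrow> 'a set \<Rightarrow> 'a set \<Rightarrow> ('a \<times> 'a) set set" where
  "ext_ideal R P J = genideal (localization R P) ((\<lambda>f. loc_frac R P f \<one>\<^bsub>R\<^esub>) ` J)"

text \<open>The contraction \<open>R \<inter> J R\<^sub>P\<close>, i.e. the preimage of \<open>J R\<^sub>P\<close> under \<open>R \<rightarrow> R\<^sub>P\<close>.\<close>

definition loc_contract :: "('a, 'c) ring_scheme \<Rightarrow> 'a set \<Rightarrow> 'a set \<Rightarrow> 'a set" where
  "loc_contract R P J = {f \<in> carrier R. loc_frac R P f \<one>\<^bsub>R\<^esub> \<in> ext_ideal R P J}"


section \<open>Associated primes, heights and symbolic powers\<close>

text \<open>The colon ideal \<open>I : f\<close> below is the annihilator of the class of \<open>f\<close> in \<open>R/I\<close>.\<close>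

definition Ass :: "('a, 'c) ring_scheme \<Rightarrow> 'a set \<Rightarrow> 'a set set" where
  "Ass R I = {P. primeideal P R \<and> (\<exists>f \<in> carrier R. P = {g \<in> carrier R. g \<otimes>\<^bsub>R\<^esub> f \<in> I})}"

definition maxAss :: "('a, 'c) ring_scheme \<Rightarrow> 'a set \<Rightarrow> 'a set set" where
  "maxAss R I = {P \<in> Ass R I. \<forall>P' \<in> Ass R I. P \<subseteq> P' \<longrightarrow> P' = P}"

definition height :: "('a, 'c) ring_scheme \<Rightarrow> 'a set \<Rightarrow> enat" where
  "height R P =
     Sup {enat k | k c. (\<forall>i\<le>k. primeideal (c i) R) \<and> (\<forall>i<k. c i \<subset> c (Suc i)) \<and> c k = P}"

definition big_height :: "('a, 'c) ring_scheme \<Rightarrow> 'a set \<Rightarrow> enat" where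
  "big_height R I = (SUP P \<in> Ass R I. height R P)"

abbreviation ideal_pow :: "('a, 'c) ring_scheme \<Rightarrow> 'a set \<Rightarrow> nat \<Rightarrow> 'a set" where
  "ideal_pow R I m \<equiv> I [^]\<^bsub>ideals_set R\<^esub> m"

definition symbolic_power :: "('a, 'c) ring_scheme \<Rightarrow> 'a set \<Rightarrow> nat \<Rightarrow> 'a set" where
  "symbolic_power R I m = carrier R \<inter> (\<Inter>P \<in> Ass R I. loc_contract R P (ideal_pow R I m))"


section \<open>Polynomial rings and monomial ideals\<close>

text \<open>
  The variables are indexed by a finite type \<open>'v\<close>, so that \<open>n + 1 = CARD('v)\<close>. A monomial is
  given by its exponent vector \<open>a :: 'v \<Rightarrow>\<^sub>0 nat\<close>.
\<close>

type_synonym ('v, 'k) mpoly = "('v \<Rightarrow>\<^sub>0 nat) \<Rightarrow>\<^sub>0 'k"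

abbreviation mpoly_ring :: "('v::finite, 'k::field) mpoly ring" where
  "mpoly_ring \<equiv> ring_of_type_algebra"

definition mon :: "('v::finite \<Rightarrow>\<^sub>0 nat) \<Rightarrow> ('v, 'k::field) mpoly" where
  "mon a = Poly_Mapping.single a 1"

definition mvar :: "'v::finite \<Rightarrow> ('v, 'k::field) mpoly" where
  "mvar i = mon (Poly_Mapping.single i 1)"

definition max_ideal :: "('v::finite, 'k::field) mpoly set" where
  "max_ideal = genideal mpoly_ring (range mvar)"

definition monomial_ideal :: "('v::finite, 'k::field) mpoly set \<Rightarrow> bool" where
  "monomial_ideal I \<longleftrightarrow> (\<exists>A. I = genideal mpoly_ring (mon ` A))"

definition mon_deg :: "('v::finite \<Rightarrow>\<^sub>0 nat) \<Rightarrow> nat" where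
  "mon_deg a = (\<Sum>i\<in>UNIV. Poly_Mapping.lookup a i)"

definition homogeneous :: "nat \<Rightarrow> ('v::finite, 'k::field) mpoly \<Rightarrow> bool" where
  "homogeneous d f \<longleftrightarrow> (\<forall>a \<in> Poly_Mapping.keys f. mon_deg a = d)"

definition initial_degree :: "('v::finite, 'k::field) mpoly set \<Rightarrow> nat" where
  "initial_degree J = (LEAST d. \<exists>f \<in> J. f \<noteq> 0 \<and> homogeneous d f)"

text \<open>
  Irredundant sets of homogeneous generators; irredundancy excludes \<open>0\<close>. For a homogeneous ideal
  the degrees occurring do not depend on the choice of such a set.
\<close>

definition minimal_generators ::
    "('v::finite, 'k::field) mpoly set \<Rightarrow> ('v, 'k) mpoly set \<Rightarrow> bool" where
  "minimal_generators I G \<longleftrightarrow>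
     (\<forall>g \<in> G. \<exists>d. homogeneous d g) \<and> genideal mpoly_ring G = I \<and>
     (\<forall>g \<in> G. genideal mpoly_ring (G - {g}) \<noteq> I)"

definition equigenerated :: "('v::finite, 'k::field) mpoly set \<Rightarrow> bool" where
  "equigenerated I \<longleftrightarrow> (\<exists>d. \<forall>G. minimal_generators I G \<longrightarrow> (\<forall>g \<in> G. homogeneous d g))"


section \<open>The symbolic polyhedron\<close>

definition exponents :: "('v::finite, 'k::field) mpoly set \<Rightarrow> ('v \<Rightarrow>\<^sub>0 nat) set" where
  "exponents M = {a. mon a \<in> M}"

definition real_vec :: "('v::finite \<Rightarrow>\<^sub>0 nat) \<Rightarrow> real ^ 'v" where
  "real_vec a = (\<chi> i. real (Poly_Mapping.lookup a i))"

definition symbolic_polyhedron :: "('v::finite, 'k::field) mpoly set \<Rightarrow> (real ^ 'v) set" where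
  "symbolic_polyhedron I =
     (\<Inter>P \<in> maxAss mpoly_ring I. convex hull (real_vec ` exponents (loc_contract mpoly_ring P I)))"

text \<open>
  The minimum of the coordinate sum. For the symbolic polyhedron of a nonzero monomial ideal it is
  attained (the polyhedron is nonempty, closed and contained in the positive orthant), so that the
  infimum is the minimum.
\<close>

definition polyhedron_alpha :: "(real ^ 'v::finite) set \<Rightarrow> real" where
  "polyhedron_alpha Q = (INF a \<in> Q. \<Sum>i\<in>UNIV. a $ i)"

end

theory Submission
  imports Defs
begin

text \<open>
  Let \<open>x^a\<close> occur in an element of \<open>I^(er)\<close>. At an associated prime \<open>P\<close>, generated by a set \<open>S\<close> of
  at most \<open>e\<close> variables, the restriction of \<open>a\<close> to \<open>S\<close> dominates a sum of \<open>er\<close> exponents of the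
  localised ideal. As these live in a space of dimension at most \<open>e\<close>, a Caratheodory argument
  concentrates the weight \<open>er\<close> on at most \<open>e\<close> of them, so one exponent \<open>b\<close> has weight at least
  \<open>r\<close> and \<open>r b \<le> a\<close> on \<open>S\<close>. Thus the floor of \<open>a / r\<close> lies in every localisation of \<open>I\<close>, hence
  in \<open>I\<close>, and \<open>a \<ge> r g\<close> for a generator \<open>g\<close>, of degree \<open>\<alpha>(I)\<close>. Since \<open>a / (er)\<close> lies in the
  symbolic polyhedron, the degree of \<open>a\<close> is at least \<open>r (\<alpha>(I) + e - 1)\<close>, and \<open>a - r g\<close> supplies
  the factor in \<open>m^((e - 1) r)\<close>.
\<close>

section \<open>Ideals and localisation in type-class rings\<close>

lemma a_inv_type_algebra [simp]:
  "a_inv (ring_of_type_algebra :: 'a::comm_ring_1 ring) x = - x"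
proof -
  interpret cring "ring_of_type_algebra :: 'a ring" by (rule cring_from_type_algebra)
  show ?thesis
    by (rule minus_equality) (auto simp: ring_of_type_algebra_def)
qed

lemma type_algebra_simps [simp]:
  "carrier ring_of_type_algebra = UNIV"
  "x \<otimes>\<^bsub>ring_of_type_algebra\<^esub> y = x * y"
  "x \<oplus>\<^bsub>ring_of_type_algebra\<^esub> y = x + y"
  "\<one>\<^bsub>ring_of_type_algebra\<^esub> = 1"
  "\<zero>\<^bsub>ring_of_type_algebra\<^esub> = 0"
  by (auto simp: ring_of_type_algebra_def)

lemma minus_type_algebra [simp]:
  "x \<ominus>\<^bsub>ring_of_type_algebra\<^esub> y = x - (y :: 'a::comm_ring_1)"
  by (simp add: a_minus_def)

lemma ideal_type_algebra_iff:
  "ideal J (ring_of_type_algebra :: 'a::comm_ring_1 ring) \<longleftrightarrow>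
     0 \<in> J \<and> (\<forall>x\<in>J. \<forall>y\<in>J. x + y \<in> J) \<and> (\<forall>x\<in>J. \<forall>c. c * x \<in> J)" (is "?L \<longleftrightarrow> ?R")
proof
  assume ?L
  then interpret ideal J ring_of_type_algebra .
  show ?R
    using additive_subgroup.zero_closed[OF is_additive_subgroup] additive_subgroup.a_closed[OF is_additive_subgroup]
      I_l_closed by auto
next
  assume R: ?R
  have "- x \<in> J" if "x \<in> J" for x
    using R that by (metis mult_minus1)
  then have "a_inv ring_of_type_algebra x \<in> J" if "x \<in> J" for x
    using that by simp
  with R have "subgroup J (add_monoid ring_of_type_algebra)"
    by (intro subgroup.intro) (auto simp: a_inv_def)
  with R show ?L
    by (intro idealI ring_from_type_algebra) (auto simp: mult.commute)
qed

lemma primeideal_type_algebra_iff: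
  "primeideal P (ring_of_type_algebra :: 'a::comm_ring_1 ring) \<longleftrightarrow>
     ideal P ring_of_type_algebra \<and> 1 \<notin> P \<and> (\<forall>x y. x * y \<in> P \<longrightarrow> x \<in> P \<or> y \<in> P)" (is "?L \<longleftrightarrow> ?R")
proof
  assume ?L
  then interpret primeideal P ring_of_type_algebra .
  have "1 \<notin> P" using one_imp_carrier I_notcarr by auto
  then show ?R using I_prime ideal_axioms by auto
next
  assume R: ?R
  then show ?L
    by (intro primeidealI cring_from_type_algebra) auto
qed

section \<open>Fractions with denominators outside \<open>P\<close>, and contraction from the
  localisation\<close>

context
  fixes P :: "'a::comm_ring_1 set"
  assumes one_P: "1 \<notin> P" and mult_P: "\<And>s t. s \<notin> P \<Longrightarrow> t \<notin> P \<Longrightarrow> s * t \<notin> P"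
begin

private abbreviation (input) "R \<equiv> ring_of_type_algebra :: 'a ring"
private abbreviation (input) "E \<equiv> frac_rel R P"
private abbreviation (input) "fr \<equiv> loc_frac R P"

lemma frac_rel_iff:
  "((a, s), (b, t)) \<in> E \<longleftrightarrow> s \<notin> P \<and> t \<notin> P \<and> (\<exists>u. u \<notin> P \<and> u * (a * t - b * s) = 0)"
  by (auto simp: frac_rel_def)

lemma equiv_frac_rel: "equiv (UNIV \<times> (UNIV - P)) E"
proof (rule equivI)
  show "E \<subseteq> (UNIV \<times> (UNIV - P)) \<times> (UNIV \<times> (UNIV - P))" by (auto simp: frac_rel_def)
  show "refl_on (UNIV \<times> (UNIV - P)) E"
    using one_P by (auto simp: refl_on_def frac_rel_iff)
  have "u * (b * s - a * t) = 0" if "u * (a * t - b * s) = 0" for u a b s t :: 'a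
    using that by (metis minus_diff_eq mult_minus_right neg_equal_0_iff_equal)
  then show "sym E"
    by (auto simp: sym_def frac_rel_iff)
  show "trans E"
  proof (rule transI)
    fix x y z assume "(x, y) \<in> E" "(y, z) \<in> E"
    moreover obtain a s b t c v where "x = (a, s)" "y = (b, t)" "z = (c, v)"
      by (metis surj_pair)
    ultimately obtain u w where u: "u \<notin> P" "u * (a * t - b * s) = 0" and w: "w \<notin> P" "w * (b * v - c * t) = 0"
      and st: "s \<notin> P" "t \<notin> P" "v \<notin> P"
      by (auto simp: frac_rel_iff)
    \<comment> \<open>Multiplying by the middle denominator \<open>t\<close> eliminates the middle
      numerator \<open>b\<close>.\<close>
    have "(u * w * t) * (a * v - c * s) = w * v * (u * (a * t - b * s)) + u * s * (w * (b * v - c * t))"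
      by (simp add: algebra_simps)
    also have "\<dots> = 0" using u w by simp
    finally have "(u * w * t) * (a * v - c * s) = 0" .
    moreover have "u * w * t \<notin> P" using u w st mult_P by blast
    ultimately show "(x, z) \<in> E"
      using \<open>x = _\<close> \<open>z = _\<close> st by (auto simp: frac_rel_iff)
  qed
qed

lemma loc_frac_eq_iff:
  "s \<notin> P \<Longrightarrow> t \<notin> P \<Longrightarrow> fr a s = fr b t \<longleftrightarrow> (\<exists>u. u \<notin> P \<and> u * (a * t - b * s) = 0)"
  unfolding loc_frac_def using eq_equiv_class_iff[OF equiv_frac_rel, of "(a, s)" "(b, t)"]
  by (auto simp: frac_rel_iff)

lemma loc_frac_eqI: "s \<notin> P \<Longrightarrow> t \<notin> P \<Longrightarrow> a * t = b * s \<Longrightarrow> fr a s = fr b t"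
  using one_P by (subst loc_frac_eq_iff) auto

lemma loc_frac_self: "s \<notin> P \<Longrightarrow> (a, s) \<in> fr a s"
  using one_P by (auto simp: loc_frac_def frac_rel_iff)

lemma loc_frac_mem: "s \<notin> P \<Longrightarrow> (b, t) \<in> fr a s \<Longrightarrow> t \<notin> P \<and> fr b t = fr a s"
  using equiv_class_eq[OF equiv_frac_rel, of "(a, s)" "(b, t)"]
  by (auto simp: loc_frac_def frac_rel_iff)

lemma carrier_localization: "carrier (localization R P) = {fr a s | a s. s \<notin> P}"
  unfolding localization_def by (auto simp: quotient_def loc_frac_def)

lemma zero_localization: "\<zero>\<^bsub>localization R P\<^esub> = fr 0 1"
  and one_localization: "\<one>\<^bsub>localization R P\<^esub> = fr 1 1"
  by (auto simp: localization_def)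

text \<open>Multiplication in \<open>localization\<close> is a union over all representatives. It
  collapses to one class because the class of the product does not depend on them: the product
  \<open>u * v\<close> of the two witnesses is again a witness.\<close>

lemma mult_localization:
  assumes "s \<notin> P" "t \<notin> P"
  shows "fr a s \<otimes>\<^bsub>localization R P\<^esub> fr b t = fr (a * b) (s * t)"
proof -
  have *: "fr (a' * b') (s' * t') = fr (a * b) (s * t)"
    if "(a', s') \<in> fr a s" "(b', t') \<in> fr b t" for a' s' b' t'
  proof -
    have st: "s' \<notin> P" "t' \<notin> P" "fr a' s' = fr a s" "fr b' t' = fr b t"
      using loc_frac_mem that assms by blast+
    then obtain u v where uv: "u \<notin> P" "u * (a' * s - a * s') = 0" "v \<notin> P" "v * (b' * t - b * t') = 0"
      using assms by (auto simp: loc_frac_eq_iff)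
    have "(u * v) * (a' * b' * (s * t) - a * b * (s' * t')) =
            v * b' * t * (u * (a' * s - a * s')) + u * a * s' * (v * (b' * t - b * t'))"
      by (simp add: algebra_simps)
    also have "\<dots> = 0" using uv by simp
    finally show ?thesis
      using uv st assms by (auto simp: loc_frac_eq_iff mult_P intro!: exI[of _ "u * v"])
  qed
  have "fr a s \<otimes>\<^bsub>localization R P\<^esub> fr b t = (\<Union>x\<in>fr a s. \<Union>y\<in>fr b t. fr (a * b) (s * t))"
    unfolding localization_def monoid.simps partial_object.simps type_algebra_simps
    by (intro SUP_cong refl) (use * in auto)
  also have "\<dots> = fr (a * b) (s * t)"
    using loc_frac_self[OF assms(1), of a] loc_frac_self[OF assms(2), of b] by auto
  finally show ?thesis .
qed

lemma add_localization:
  assumes "s \<notin> P" "t \<notin> P"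
  shows "fr a s \<oplus>\<^bsub>localization R P\<^esub> fr b t = fr (a * t + b * s) (s * t)"
proof -
  have *: "fr (a' * t' + b' * s') (s' * t') = fr (a * t + b * s) (s * t)"
    if "(a', s') \<in> fr a s" "(b', t') \<in> fr b t" for a' s' b' t'
  proof -
    have st: "s' \<notin> P" "t' \<notin> P" "fr a' s' = fr a s" "fr b' t' = fr b t"
      using loc_frac_mem that assms by blast+
    then obtain u v where uv: "u \<notin> P" "u * (a' * s - a * s') = 0" "v \<notin> P" "v * (b' * t - b * t') = 0"
      using assms by (auto simp: loc_frac_eq_iff)
    have "(u * v) * ((a' * t' + b' * s') * (s * t) - (a * t + b * s) * (s' * t')) =
            v * t * t' * (u * (a' * s - a * s')) + u * s * s' * (v * (b' * t - b * t'))"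
      by (simp add: algebra_simps)
    also have "\<dots> = 0" using uv by simp
    finally show ?thesis
      using uv st assms by (auto simp: loc_frac_eq_iff mult_P intro!: exI[of _ "u * v"])
  qed
  have "fr a s \<oplus>\<^bsub>localization R P\<^esub> fr b t = (\<Union>x\<in>fr a s. \<Union>y\<in>fr b t. fr (a * t + b * s) (s * t))"
    unfolding localization_def ring.simps type_algebra_simps
    by (intro SUP_cong refl) (use * in auto)
  also have "\<dots> = fr (a * t + b * s) (s * t)"
    using loc_frac_self[OF assms(1), of a] loc_frac_self[OF assms(2), of b] by auto
  finally show ?thesis .
qed

lemma loc_frac_closed: "s \<notin> P \<Longrightarrow> fr a s \<in> carrier (localization R P)"
  by (auto simp: carrier_localization)

lemma localizationE:
  assumes "x \<in> carrier (localization R P)"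
  obtains a s where "x = fr a s" "s \<notin> P"
  using assms by (auto simp: carrier_localization)

lemmas localization_simps = loc_frac_closed zero_localization one_localization
  mult_localization add_localization mult_P one_P

lemma cring_localization: "cring (localization R P)"
proof (rule cringI)
  show "abelian_group (localization R P)"
  proof (rule abelian_groupI, goal_cases)
    case (1 x y)
    then show ?case by (elim localizationE) (simp add: localization_simps)
  next
    case 2
    show ?case by (simp add: localization_simps)
  next
    case (3 x y z)
    then show ?case
      by (elim localizationE) (simp add: localization_simps, simp add: algebra_simps)
  next
    case (4 x y)
    then show ?case by (elim localizationE) (simp add: localization_simps add.commute mult.commute)
  next
    case (5 x)
    then show ?case by (elim localizationE) (simp add: localization_simps)
  next
    case (6 x)
    then obtain a s where x: "x = fr a s" "s \<notin> P" by (rule localizationE)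
    have "fr (- a) s \<oplus>\<^bsub>localization R P\<^esub> x = fr (- a * s + a * s) (s * s)"
      using x by (simp add: localization_simps)
    also have "\<dots> = fr 0 1"
      using x by (intro loc_frac_eqI) (simp_all add: mult_P one_P)
    finally have "fr (- a) s \<oplus>\<^bsub>localization R P\<^esub> x = \<zero>\<^bsub>localization R P\<^esub>"
      by (simp only: zero_localization)
    with loc_frac_closed[OF x(2)] show ?case by blast
  qed
  show "Group.comm_monoid (localization R P)"
  proof (rule comm_monoidI, goal_cases)
    case (1 x y)
    then show ?case by (elim localizationE) (simp add: localization_simps)
  next
    case 2
    show ?case by (simp add: localization_simps)
  next
    case (3 x y z)
    then show ?case by (elim localizationE) (simp add: localization_simps mult.assoc)
  next
    case (4 x)
    then show ?case by (elim localizationE) (simp add: localization_simps)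
  next
    case (5 x y)
    then show ?case by (elim localizationE) (simp add: localization_simps mult.commute)
  qed
  show "(x \<oplus>\<^bsub>localization R P\<^esub> y) \<otimes>\<^bsub>localization R P\<^esub> z =
     x \<otimes>\<^bsub>localization R P\<^esub> z \<oplus>\<^bsub>localization R P\<^esub> y \<otimes>\<^bsub>localization R P\<^esub> z"
    if x: "x \<in> carrier (localization R P)" and y: "y \<in> carrier (localization R P)"
      and z: "z \<in> carrier (localization R P)"
    for x y z
  proof -
    obtain a s where x: "x = fr a s" and s: "s \<notin> P" using x by (rule localizationE)
    obtain b t where y: "y = fr b t" and t: "t \<notin> P" using y by (rule localizationE)
    obtain c v where z: "z = fr c v" and v: "v \<notin> P" using z by (rule localizationE)
    have "fr ((a * t + b * s) * c) (s * t * v) = fr (a * c * (t * v) + b * c * (s * v)) (s * v * (t * v))"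
      by (intro loc_frac_eqI mult_P s t v) (simp add: algebra_simps)
    with s t v show ?thesis
      by (simp add: x y z localization_simps)
  qed
qed

text \<open>Bounds the extension of \<open>J\<close> from above: these fractions form an ideal that
  contains the image of \<open>J\<close>.\<close>

lemma ideal_fractions:
  assumes "ideal J R"
  shows "ideal {fr a s | a s. a \<in> J \<and> s \<notin> P} (localization R P)" (is "ideal ?K _")
proof -
  interpret L: cring "localization R P" by (rule cring_localization)
  have J: "0 \<in> J" "x \<in> J \<Longrightarrow> y \<in> J \<Longrightarrow> x + y \<in> J" "x \<in> J \<Longrightarrow> c * x \<in> J" "x \<in> J \<Longrightarrow> x * c \<in> J" for x y c
    using assms by (auto simp: ideal_type_algebra_iff mult.commute)
  have K: "fr a s \<in> ?K" if "a \<in> J" "s \<notin> P" for a s using that by blast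
  have KC: "?K \<subseteq> carrier (localization R P)" using loc_frac_closed by blast
  have left: "x \<otimes>\<^bsub>localization R P\<^esub> k \<in> ?K"
    if k: "k \<in> ?K" and x: "x \<in> carrier (localization R P)" for k x
  proof -
    obtain a s where "k = fr a s" "a \<in> J" "s \<notin> P" using k by blast
    moreover obtain b t where "x = fr b t" "t \<notin> P" using x by (rule localizationE)
    ultimately show ?thesis using K[of "b * a" "t * s"] J by (simp only: mult_localization mult_P not_False_eq_True)
  qed
  show ?thesis
  proof (rule idealI)
    show "subgroup ?K (add_monoid (localization R P))"
    proof (rule L.add.subgroupI)
      show "?K \<subseteq> carrier (localization R P)" by (rule KC)
      show "?K \<noteq> {}" using J(1) one_P by blast
      show "x \<oplus>\<^bsub>localization R P\<^esub> y \<in> ?K" if x: "x \<in> ?K" and y: "y \<in> ?K" for x y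
      proof -
        obtain a s where "x = fr a s" "a \<in> J" "s \<notin> P" using x by blast
        moreover obtain b t where "y = fr b t" "b \<in> J" "t \<notin> P" using y by blast
        ultimately show ?thesis
          using K[of "a * t + b * s" "s * t"] J by (simp only: add_localization mult_P not_False_eq_True)
      qed
      show "\<ominus>\<^bsub>localization R P\<^esub> x \<in> ?K" if "x \<in> ?K" for x
      proof -
        have x: "x \<in> carrier (localization R P)" using that KC by blast
        then have "\<ominus>\<^bsub>localization R P\<^esub> x = (\<ominus>\<^bsub>localization R P\<^esub> \<one>\<^bsub>localization R P\<^esub>) \<otimes>\<^bsub>localization R P\<^esub> x"
          by (simp add: L.l_minus)
        then show ?thesis using left[OF that, of "\<ominus>\<^bsub>localization R P\<^esub> \<one>\<^bsub>localization R P\<^esub>"] by simp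
      qed
    qed
    show "x \<otimes>\<^bsub>localization R P\<^esub> k \<in> ?K"
      if "k \<in> ?K" "x \<in> carrier (localization R P)" for k x using that by (rule left)
    show "k \<otimes>\<^bsub>localization R P\<^esub> x \<in> ?K"
      if "k \<in> ?K" "x \<in> carrier (localization R P)" for k x
    proof -
      have "k \<in> carrier (localization R P)" using that KC by blast
      then have "k \<otimes>\<^bsub>localization R P\<^esub> x = x \<otimes>\<^bsub>localization R P\<^esub> k"
        using that(2) by (rule L.m_comm)
      then show ?thesis using left[OF that] by argo
    qed
  qed (rule L.ring_axioms)
qed

text \<open>If \<open>f/1 = a/s\<close> with \<open>a\<close> in \<open>J\<close>, clearing
  denominators gives \<open>(u * s) * f = u * a\<close> in \<open>J\<close>. Conversely
  \<open>f/1\<close> is \<open>1/s\<close> times \<open>(s * f)/1\<close>, so it lies in every ideal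
  containing the image of \<open>J\<close>.\<close>

lemma loc_contract_eq:
  assumes J: "ideal J R"
  shows "loc_contract R P J = {f. \<exists>s. s \<notin> P \<and> s * f \<in> J}"
proof (intro Set.set_eqI iffI CollectI)
  fix f assume "f \<in> loc_contract R P J"
  then have f: "fr f 1 \<in> genideal (localization R P) ((\<lambda>f. fr f 1) ` J)"
    by (simp add: loc_contract_def ext_ideal_def)
  have "(\<lambda>f. fr f 1) ` J \<subseteq> {fr a s | a s. a \<in> J \<and> s \<notin> P}" using one_P by blast
  with f ideal_fractions[OF J] have "fr f 1 \<in> {fr a s | a s. a \<in> J \<and> s \<notin> P}"
    unfolding genideal_def by blast
  then obtain a s where as: "fr f 1 = fr a s" "a \<in> J" "s \<notin> P" by blast
  then obtain u where u: "u \<notin> P" "u * (f * s - a) = 0"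
    using loc_frac_eq_iff one_P by auto
  have "(u * s) * f = u * a" using u(2) by (simp add: algebra_simps)
  then have "(u * s) * f \<in> J" using J as by (auto simp: ideal_type_algebra_iff)
  then show "\<exists>s. s \<notin> P \<and> s * f \<in> J" using mult_P u as by blast
next
  fix f assume "f \<in> {f. \<exists>s. s \<notin> P \<and> s * f \<in> J}"
  then obtain s where s: "s \<notin> P" "s * f \<in> J" by blast
  have "fr f 1 \<in> K" if "ideal K (localization R P)" "(\<lambda>f. fr f 1) ` J \<subseteq> K" for K
  proof -
    have "fr 1 s \<otimes>\<^bsub>localization R P\<^esub> fr (s * f) 1 \<in> K"
      using that s by (intro ideal.I_l_closed[OF that(1)]) (auto simp: carrier_localization)
    moreover have "fr 1 s \<otimes>\<^bsub>localization R P\<^esub> fr (s * f) 1 = fr (1 * (s * f)) (s * 1)"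
      using s(1) one_P by (rule mult_localization)
    moreover have "fr (1 * (s * f)) (s * 1) = fr f 1"
      using s(1) one_P by (intro loc_frac_eqI) (simp_all add: mult.commute)
    ultimately show ?thesis by simp
  qed
  then show "f \<in> loc_contract R P J"
    by (auto simp: loc_contract_def ext_ideal_def genideal_def)
qed

end

section \<open>Concentrating weights\<close>

text \<open>Gaussian elimination by induction on the equations: an equation that vanishes
  identically is dropped; otherwise a pivot \<open>p\<close> is eliminated from the others, and back
  substitution gives its value \<open>q\<close>.\<close>

lemma homogeneous_system_nontrivial_solution:
  fixes M :: "'i \<Rightarrow> 'j \<Rightarrow> 'k::field"
  assumes "finite S" "finite J" "card S < card J"
  shows "\<exists>c. (\<exists>j\<in>J. c j \<noteq> 0) \<and> (\<forall>i\<in>S. (\<Sum>j\<in>J. c j * M i j) = 0)"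
  using assms
proof (induction S arbitrary: J M rule: finite_induct)
  case empty
  then have "J \<noteq> {}" by auto
  then show ?case by (intro exI[of _ "\<lambda>_. 1"]) auto
next
  case (insert i S J M)
  show ?case
  proof (cases "\<forall>j\<in>J. M i j = 0")
    case True
    obtain c where "\<exists>j\<in>J. c j \<noteq> 0" "\<forall>i\<in>S. (\<Sum>j\<in>J. c j * M i j) = 0"
      using insert.IH[of J M] insert.prems insert.hyps by auto
    with True show ?thesis by (intro exI[of _ c]) auto
  next
    case False
    then obtain p where p: "p \<in> J" "M i p \<noteq> 0" by blast
    define J' where "J' = J - {p}"
    have J': "finite J'" "J = insert p J'" "p \<notin> J'" using p insert.prems by (auto simp: J'_def)
    have "card S < card J'" using insert.prems insert.hyps J' by simp
    then obtain c where c: "\<exists>j\<in>J'. c j \<noteq> 0"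
      "\<forall>k\<in>S. (\<Sum>j\<in>J'. c j * (M k j - M k p * M i j / M i p)) = 0"
      using insert.IH[of J' "\<lambda>k j. M k j - M k p * M i j / M i p"] J' by blast
    define q where "q = - (\<Sum>j\<in>J'. c j * M i j) / M i p"
    define c' where "c' = c(p := q)"
    have sum: "(\<Sum>j\<in>J. c' j * M k j) = (\<Sum>j\<in>J'. c j * M k j) + q * M k p" for k
    proof -
      have "(\<Sum>j\<in>J'. c' j * M k j) = (\<Sum>j\<in>J'. c j * M k j)"
        using J' by (intro sum.cong) (auto simp: c'_def)
      then show ?thesis using J' by (simp add: c'_def)
    qed
    have "(\<Sum>j\<in>J. c' j * M k j) = 0" if "k \<in> insert i S" for k
    proof (cases "k = i")
      case True
      then show ?thesis using p by (simp add: sum q_def)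
    next
      case False
      then have "0 = (\<Sum>j\<in>J'. c j * (M k j - M k p * M i j / M i p))" using c(2) that by auto
      also have "\<dots> = (\<Sum>j\<in>J'. c j * M k j) - (\<Sum>j\<in>J'. c j * M i j) * (M k p / M i p)"
        unfolding sum_distrib_right sum_subtractf[symmetric]
        by (intro sum.cong) (auto simp: algebra_simps)
      finally show ?thesis by (simp add: sum q_def)
    qed
    moreover have "\<exists>j\<in>J. c' j \<noteq> 0" using c(1) J' by (auto simp: c'_def)
    ultimately show ?thesis by blast
  qed
qed

text \<open>
  A weighting with more than \<open>card S\<close>
  vectors in its support admits a linear relation, along which the total weight can be kept from
  decreasing until some weight vanishes; with at most \<open>card S\<close> vectors, some weight is at least \<open>r\<close>.
\<close>

lemma exists_heavy_vector:
  fixes M :: "'i \<Rightarrow> 'j \<Rightarrow> real"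
  assumes "finite S" "S \<noteq> {}" "finite J" "r > 0"
    and "\<And>i j. i \<in> S \<Longrightarrow> j \<in> J \<Longrightarrow> M i j \<ge> 0"
    and "\<And>j. j \<in> J \<Longrightarrow> w j \<ge> 0"
    and "\<And>i. i \<in> S \<Longrightarrow> (\<Sum>j\<in>J. w j * M i j) \<le> a i"
    and "(\<Sum>j\<in>J. w j) \<ge> real (card S) * r"
  shows "\<exists>j\<in>J. \<forall>i\<in>S. r * M i j \<le> a i"
  using assms(3,5-)
proof (induction "card J" arbitrary: J w)
  case 0
  \<comment> \<open>With no vectors the total weight is 0, below \<open>card S * r\<close> because
    \<open>S\<close> is nonempty and \<open>r\<close> positive.\<close>
  then show ?case using assms(1,2,4) by (simp add: mult_le_0_iff card_eq_0_iff)
next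
  case (Suc n J w)
  note M = Suc.prems(2) and w = Suc.prems(3) and wM = Suc.prems(4) and wsum = Suc.prems(5)
  have J: "finite J" "J \<noteq> {}" using Suc.hyps(2) Suc.prems(1) by auto
  show ?case
  proof (cases "card J \<le> card S")
    case True
    have "\<exists>j\<in>J. w j \<ge> r"
    proof (rule ccontr)
      assume "\<not> ?thesis"
      then have "(\<Sum>j\<in>J. w j) < (\<Sum>j\<in>J. r)" using J by (intro sum_strict_mono) auto
      also have "\<dots> \<le> real (card S) * r" using True assms(4) by (simp add: mult_right_mono)
      finally show False using wsum by simp
    qed
    then obtain j where j: "j \<in> J" "w j \<ge> r" by blast
    have "r * M i j \<le> a i" if i: "i \<in> S" for i
    proof -
      have "r * M i j \<le> w j * M i j" using j M i by (simp add: mult_right_mono)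
      also have "\<dots> \<le> (\<Sum>j\<in>J. w j * M i j)" using j M i w J by (intro member_le_sum) auto
      finally show ?thesis using wM[OF i] by simp
    qed
    with j show ?thesis by blast
  next
    case False
    then obtain c0 where c0: "\<exists>j\<in>J. c0 j \<noteq> 0" "\<forall>i\<in>S. (\<Sum>j\<in>J. c0 j * M i j) = 0"
      using homogeneous_system_nontrivial_solution[OF assms(1) J(1), of M] by auto
    \<comment> \<open>The sign is chosen so that the coefficient sum is nonnegative; adding
      multiples of \<open>c\<close> then never lowers the total weight.\<close>
    define c where "c j = (if (\<Sum>j\<in>J. c0 j) \<ge> 0 then c0 j else - c0 j)" for j
    have csum: "(\<Sum>j\<in>J. c j) \<ge> 0"
      by (cases "(\<Sum>j\<in>J. c0 j) \<ge> 0") (simp_all add: c_def sum_negf)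
    have c: "\<exists>j\<in>J. c j \<noteq> 0" using c0(1) by (auto simp: c_def)
    have cM: "(\<Sum>j\<in>J. c j * M i j) = 0" if "i \<in> S" for i
      using c0(2) that by (cases "(\<Sum>j\<in>J. c0 j) \<ge> 0") (simp_all add: c_def sum_negf)
    have a: "a i \<ge> 0" if "i \<in> S" for i
    proof -
      have "0 \<le> (\<Sum>j\<in>J. w j * M i j)" using M w that by (intro sum_nonneg) auto
      then show ?thesis using wM[OF that] by simp
    qed
    show ?thesis
    proof (cases "\<forall>j\<in>J. c j \<ge> 0")
      case True
      \<comment> \<open>For a nonnegative relation every term \<open>c j * M i j\<close> vanishes,
        so a vector with nonzero coefficient is zero on \<open>S\<close> and is dominated
        trivially.\<close>
      obtain j where j: "j \<in> J" "c j \<noteq> 0" using c by blast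
      have "M i j = 0" if i: "i \<in> S" for i
      proof -
        have "\<forall>j\<in>J. c j * M i j = 0"
          using cM[OF i] True M i J by (subst (asm) sum_nonneg_eq_0_iff) auto
        then show ?thesis using j by auto
      qed
      with a j show ?thesis by (intro bexI[of _ j] ballI) auto
    next
      case False
      define N where "N = {j \<in> J. c j < 0}"
      have N: "finite N" "N \<noteq> {}" using False J by (auto simp: N_def)
      \<comment> \<open>The largest multiple of \<open>c\<close> that keeps all weights nonnegative;
        the weight of the minimiser \<open>p\<close> becomes 0, so \<open>p\<close> can be
        removed.\<close>
      define t where "t = Min ((\<lambda>j. w j / - c j) ` N)"
      have "t \<in> (\<lambda>j. w j / - c j) ` N" unfolding t_def using N by (intro Min_in) auto
      then obtain p where p: "p \<in> N" "t = w p / - c p" by auto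
      have t_le: "t \<le> w j / - c j" if "j \<in> N" for j unfolding t_def using N that by auto
      have t: "t \<ge> 0" using p w by (auto simp: N_def divide_nonneg_neg)
      define w' where "w' j = w j + t * c j" for j
      have w'_nonneg: "w' j \<ge> 0" if "j \<in> J" for j
      proof (cases "c j < 0")
        case True
        then have "t \<le> w j / - c j" using t_le that by (auto simp: N_def)
        then show ?thesis using True by (simp add: w'_def field_simps)
      next
        case False
        then show ?thesis using t w[OF that] by (simp add: w'_def)
      qed
      have p': "p \<in> J" "w' p = 0" using p by (auto simp: N_def w'_def)
      have drop: "(\<Sum>j\<in>J - {p}. w' j * f j) = (\<Sum>j\<in>J. w' j * f j)" for f :: "'j \<Rightarrow> real"
        using p' J by (simp add: sum.remove)
      have "\<exists>j\<in>J - {p}. \<forall>i\<in>S. r * M i j \<le> a i"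
      proof (rule Suc.hyps(1)[of "J - {p}" w'])
        show "n = card (J - {p})" using Suc.hyps(2) p' J by simp
        show "finite (J - {p})" using J by simp
        show "M i j \<ge> 0" if "i \<in> S" "j \<in> J - {p}" for i j using M that by auto
        show "w' j \<ge> 0" if "j \<in> J - {p}" for j using w'_nonneg that by auto
        show "(\<Sum>j\<in>J - {p}. w' j * M i j) \<le> a i" if i: "i \<in> S" for i
        proof -
          have "(\<Sum>j\<in>J. w' j * M i j) = (\<Sum>j\<in>J. w j * M i j) + t * (\<Sum>j\<in>J. c j * M i j)"
            by (simp add: w'_def algebra_simps sum.distrib sum_distrib_left)
          then show ?thesis using cM[OF i] wM[OF i] by (simp add: drop)
        qed
        have "(\<Sum>j\<in>J. w' j) = (\<Sum>j\<in>J. w j) + t * (\<Sum>j\<in>J. c j)"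
          by (simp add: w'_def sum.distrib sum_distrib_left)
        also have "\<dots> \<ge> (\<Sum>j\<in>J. w j)" using t csum by simp
        finally show "(\<Sum>j\<in>J - {p}. w' j) \<ge> real (card S) * r"
          using wsum drop[of "\<lambda>_. 1"] by simp
      qed
      then show ?thesis by blast
    qed
  qed
qed

section \<open>Monomial ideals\<close>

lemma exponent_le_iff:
  fixes a b :: "'v \<Rightarrow>\<^sub>0 nat"
  shows "(\<forall>i. Poly_Mapping.lookup b i \<le> Poly_Mapping.lookup a i) \<longleftrightarrow> (\<exists>c. a = b + c)"
proof
  assume "\<forall>i. Poly_Mapping.lookup b i \<le> Poly_Mapping.lookup a i"
  then have "a = b + (a - b)" by (intro poly_mapping_eqI) (simp add: lookup_add lookup_minus)
  then show "\<exists>c. a = b + c" by blast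
qed (auto simp: lookup_add)

text \<open>On a finite type every function has finite support, so \<open>Abs_poly_mapping\<close>
  applies without a side condition.\<close>

definition exponent_of :: "('v::finite \<Rightarrow> nat) \<Rightarrow> ('v \<Rightarrow>\<^sub>0 nat)" where
  "exponent_of f = Abs_poly_mapping f"

lemma lookup_exponent_of [simp]: "Poly_Mapping.lookup (exponent_of f) = f"
  by (simp add: exponent_of_def)

text \<open>For \<open>T = - S\<close> these are the monomials outside the prime generated by the
  variables in \<open>S\<close>, that is, those that become units in the localisation.\<close>

definition exponents_in :: "'v set \<Rightarrow> ('v::finite \<Rightarrow>\<^sub>0 nat) set" where
  "exponents_in T = {a. Poly_Mapping.keys a \<subseteq> T}"

lemma exponents_in_iff: "a \<in> exponents_in T \<longleftrightarrow> (\<forall>i. i \<notin> T \<longrightarrow> Poly_Mapping.lookup a i = 0)"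
  by (auto simp: exponents_in_def in_keys_iff)

lemma exponents_in_0 [simp]: "0 \<in> exponents_in T"
  by (simp add: exponents_in_iff)

lemma exponents_in_add: "a \<in> exponents_in T \<Longrightarrow> b \<in> exponents_in T \<Longrightarrow> a + b \<in> exponents_in T"
  by (simp add: exponents_in_iff lookup_add)

lemma exponents_in_sum: "(\<And>x. x \<in> Y \<Longrightarrow> t x \<in> exponents_in T) \<Longrightarrow> sum t Y \<in> exponents_in T"
  by (simp add: exponents_in_iff lookup_sum)

lemma exponents_in_mono: "S \<subseteq> T \<Longrightarrow> exponents_in S \<subseteq> exponents_in T"
  by (auto simp: exponents_in_def)

lemma exponents_in_split:
  fixes a :: "'v::finite \<Rightarrow>\<^sub>0 nat"
  obtains b c where "a = b + c" "b \<in> exponents_in S" "c \<in> exponents_in (- S)"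
proof (rule that)
  show "a = exponent_of (\<lambda>i. if i \<in> S then Poly_Mapping.lookup a i else 0) +
      exponent_of (\<lambda>i. if i \<in> S then 0 else Poly_Mapping.lookup a i)"
    by (intro poly_mapping_eqI) (simp add: lookup_add)
qed (auto simp: exponents_in_iff)

lemma exponent_nonzeroE:
  fixes a :: "'v \<Rightarrow>\<^sub>0 nat"
  assumes "Poly_Mapping.lookup a i \<noteq> 0"
  obtains b where "a = Poly_Mapping.single i 1 + b"
proof -
  have "\<forall>j. Poly_Mapping.lookup (Poly_Mapping.single i 1) j \<le> Poly_Mapping.lookup a j"
    using assms by (auto simp: lookup_single when_def)
  then show ?thesis using that exponent_le_iff[of "Poly_Mapping.single i 1" a] by blast
qed

lemma exponent_neq_0E:
  fixes a :: "'v \<Rightarrow>\<^sub>0 nat"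
  assumes "a \<noteq> 0"
  obtains i b where "a = Poly_Mapping.single i 1 + b"
proof -
  obtain i where "Poly_Mapping.lookup a i \<noteq> 0"
    using assms poly_mapping_eqI[of a 0] by force
  then show ?thesis using exponent_nonzeroE that by metis
qed

lemma mon_deg_add [simp]: "mon_deg (a + b) = mon_deg a + mon_deg b"
  by (simp add: mon_deg_def lookup_add sum.distrib)

lemma mon_deg_0 [simp]: "mon_deg 0 = 0"
  by (simp add: mon_deg_def)

lemma mon_deg_single [simp]: "mon_deg (Poly_Mapping.single i n) = n"
  by (simp add: mon_deg_def lookup_single when_def)

lemma mon_deg_eq_0_iff [simp]: "mon_deg a = 0 \<longleftrightarrow> a = 0"
  by (auto simp: mon_deg_def intro: poly_mapping_eqI)

lemma mon_add: "mon (a + b) = mon a * mon b"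
  by (simp add: mon_def mult_single)

lemma mon_0: "mon 0 = 1"
  by (simp add: mon_def)

lemma keys_mon [simp]: "Poly_Mapping.keys (mon a :: ('v::finite, 'k::field) mpoly) = {a}"
  by (simp add: mon_def)

lemma poly_mapping_eq_sum_single:
  "f = (\<Sum>a\<in>Poly_Mapping.keys f. Poly_Mapping.single a (Poly_Mapping.lookup f a))"
  by (rule poly_mapping_eqI)
     (auto simp: lookup_sum lookup_single when_def in_keys_iff sum.delta)

text \<open>Only one pair of terms contributes to this coefficient of the product, so nothing can
  cancel.\<close>

lemma lookup_mult_unique:
  assumes "t \<in> Poly_Mapping.keys s" "a \<in> Poly_Mapping.keys f"
    and "\<And>t' a'. t' \<in> Poly_Mapping.keys s \<Longrightarrow> a' \<in> Poly_Mapping.keys f \<Longrightarrow> t' + a' = t + a \<Longrightarrow> t' = t \<and> a' = a"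
  shows "Poly_Mapping.lookup (s * f) (t + a) = Poly_Mapping.lookup s t * Poly_Mapping.lookup f a"
proof -
  let ?s = "Poly_Mapping.lookup s" and ?f = "Poly_Mapping.lookup f"
  have "s * f = (\<Sum>x\<in>Poly_Mapping.keys s. \<Sum>y\<in>Poly_Mapping.keys f. Poly_Mapping.single (x + y) (?s x * ?f y))"
    using arg_cong2[OF poly_mapping_eq_sum_single[of s] poly_mapping_eq_sum_single[of f], of "(*)"]
    by (simp add: sum_product mult_single)
  then have "Poly_Mapping.lookup (s * f) (t + a) =
     (\<Sum>x\<in>Poly_Mapping.keys s. \<Sum>y\<in>Poly_Mapping.keys f. (?s x * ?f y when x + y = t + a))"
    by (simp add: lookup_sum lookup_single)
  also have "\<dots> = (\<Sum>x\<in>Poly_Mapping.keys s. \<Sum>y\<in>Poly_Mapping.keys f.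
                   if y = a then (if x = t then ?s x * ?f y else 0) else 0)"
    using assms(3) by (intro sum.cong refl) (auto simp: when_def)
  also have "\<dots> = ?s t * ?f a" using assms(1,2) by simp
  finally show ?thesis .
qed

section \<open>Ideals spanned by monomials\<close>

definition monomial_span :: "('v::finite \<Rightarrow>\<^sub>0 nat) set \<Rightarrow> ('v, 'k::field) mpoly set" where
  "monomial_span U = {f. Poly_Mapping.keys f \<subseteq> U}"

text \<open>The condition on the exponents under which a span of monomials is an ideal.\<close>

definition exponent_upset :: "('v::finite \<Rightarrow>\<^sub>0 nat) set \<Rightarrow> bool" where
  "exponent_upset U \<longleftrightarrow> (\<forall>a\<in>U. \<forall>c. a + c \<in> U)"

lemma exponent_upsetD: "exponent_upset U \<Longrightarrow> a \<in> U \<Longrightarrow> a + c \<in> U"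
  by (simp add: exponent_upset_def)

lemma mon_in_monomial_span [simp]: "mon a \<in> monomial_span U \<longleftrightarrow> a \<in> U"
  by (simp add: monomial_span_def)

lemma exponents_monomial_span [simp]:
  "exponents (monomial_span U :: ('v::finite, 'k::field) mpoly set) = U"
  by (simp add: exponents_def)

lemma ideal_monomial_span:
  assumes "exponent_upset U"
  shows "ideal (monomial_span U :: ('v::finite, 'k::field) mpoly set) mpoly_ring"
  unfolding ideal_type_algebra_iff
proof (intro conjI ballI allI)
  fix f g c :: "('v, 'k) mpoly" assume f: "f \<in> monomial_span U"
  show "c * f \<in> monomial_span U"
    using f keys_mult[of c f] assms
    by (fastforce simp: monomial_span_def exponent_upset_def add.commute)
  assume "g \<in> monomial_span U"
  then show "f + g \<in> monomial_span U"
    using f keys_add[of f g] by (auto simp: monomial_span_def)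
qed (simp add: monomial_span_def)

lemma monomial_span_subset_ideal:
  fixes J :: "('v::finite, 'k::field) mpoly set"
  assumes J: "ideal J mpoly_ring" and U: "\<And>a. a \<in> U \<Longrightarrow> mon a \<in> J"
  shows "monomial_span U \<subseteq> J"
proof
  fix f :: "('v, 'k) mpoly" assume f: "f \<in> monomial_span U"
  have J': "0 \<in> J" "\<And>x y. x \<in> J \<Longrightarrow> y \<in> J \<Longrightarrow> x + y \<in> J" "\<And>c x. x \<in> J \<Longrightarrow> c * x \<in> J"
    using J by (auto simp: ideal_type_algebra_iff)
  have single: "Poly_Mapping.single a c \<in> J" if "a \<in> U" for a c
    using J'(3)[OF U[OF that], of "Poly_Mapping.single 0 c"] by (simp add: mon_def mult_single)
  have keys: "Poly_Mapping.keys f \<subseteq> U" using f by (simp add: monomial_span_def)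
  have sum: "sum h Y \<in> J" if "\<And>a. a \<in> Y \<Longrightarrow> h a \<in> J" for Y and h :: "_ \<Rightarrow> ('v, 'k) mpoly"
    using that by (induction Y rule: infinite_finite_induct) (auto intro: J')
  have "(\<Sum>a\<in>Poly_Mapping.keys f. Poly_Mapping.single a (Poly_Mapping.lookup f a)) \<in> J"
    by (rule sum, rule single) (use keys in auto)
  then show "f \<in> J" by (subst poly_mapping_eq_sum_single[of f])
qed

lemma exponent_upset_multiples: "exponent_upset {b + c | b c. b \<in> A}"
  unfolding exponent_upset_def by (auto simp: add.assoc) blast

text \<open>The multiples of the generating monomials span an ideal, and every ideal with these
  generators contains all the multiples.\<close>

lemma genideal_mon:
  "genideal mpoly_ring (mon ` A) = (monomial_span {b + c | b c. b \<in> A} :: ('v::finite, 'k::field) mpoly set)"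
    (is "?L = ?R")
proof
  have "A \<subseteq> {b + c | b c. b \<in> A}" by (force intro: exI[of _ 0])
  then have "mon ` A \<subseteq> ?R" by auto
  then show "?L \<subseteq> ?R"
    using ideal_monomial_span[OF exponent_upset_multiples] unfolding genideal_def by blast
  show "?R \<subseteq> ?L"
    unfolding genideal_def
  proof (rule Inter_greatest, clarify)
    fix J :: "('v, 'k) mpoly set" and f :: "('v, 'k) mpoly"
    assume J: "ideal J mpoly_ring" "mon ` A \<subseteq> J" and f: "f \<in> ?R"
    have "mon (b + c) \<in> J" if "b \<in> A" for b c
    proof -
      have "mon c * mon b \<in> J" using J that unfolding ideal_type_algebra_iff by blast
      then show ?thesis by (simp add: mon_add mult.commute)
    qed
    then show "f \<in> J" using monomial_span_subset_ideal[OF J(1), of "{b + c | b c. b \<in> A}"] f by blast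
  qed
qed

lemma monomial_ideal_eq_span:
  fixes I :: "('v::finite, 'k::field) mpoly set"
  assumes "monomial_ideal I"
  shows "I = monomial_span (exponents I)" "exponent_upset (exponents I)"
proof -
  obtain A where "I = genideal mpoly_ring (mon ` A)" using assms by (auto simp: monomial_ideal_def)
  then have I: "I = monomial_span {b + c | b c. b \<in> A}" by (simp only: genideal_mon)
  then have "exponents I = {b + c | b c. b \<in> A}" by simp
  with I show "I = monomial_span (exponents I)" "exponent_upset (exponents I)"
    using exponent_upset_multiples[of A] by simp_all
qed

section \<open>Products and powers of monomial ideals as sumsets of exponents\<close>

lemma ideal_prod_monomial_span:
  assumes U: "exponent_upset U" and V: "exponent_upset V"
  shows "ideal_prod mpoly_ring (monomial_span U) (monomial_span V) =
           (monomial_span {a + b | a b. a \<in> U \<and> b \<in> V} :: ('v::finite, 'k::field) mpoly set)"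
    (is "?L = ?R")
proof
  interpret cring "mpoly_ring :: ('v, 'k) mpoly ring" by (rule cring_from_type_algebra)
  show "?L \<subseteq> ?R"
  proof
    fix f :: "('v, 'k) mpoly" assume "f \<in> ?L"
    then show "f \<in> ?R"
    proof induction
      case (prod f g)
      then show ?case using keys_mult[of f g] by (fastforce simp: monomial_span_def)
    next
      case (sum f g)
      then show ?case using keys_add[of f g] by (auto simp: monomial_span_def)
    qed
  qed
  show "?R \<subseteq> ?L"
  proof (rule monomial_span_subset_ideal)
    show "ideal ?L mpoly_ring"
      using U V by (intro ideal_prod_is_ideal ideal_monomial_span)
    fix x assume "x \<in> {a + b | a b. a \<in> U \<and> b \<in> V}"
    then obtain a b where ab: "x = a + b" "a \<in> U" "b \<in> V" by blast
    then have "mon a \<otimes>\<^bsub>mpoly_ring\<^esub> mon b \<in> ?L" by (intro ideal_prod.prod) auto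
    then show "mon x \<in> ?L" by (simp add: ab mon_add)
  qed
qed

text \<open>The base case is \<open>UNIV\<close>, not \<open>{0}\<close>, because the zeroth power
  of an ideal is the whole ring. It accounts for the free summand \<open>u\<close> in
  \<open>sumset_powE\<close>.\<close>

primrec sumset_pow :: "'e::comm_monoid_add set \<Rightarrow> nat \<Rightarrow> 'e set" where
  "sumset_pow U 0 = UNIV"
| "sumset_pow U (Suc n) = {a + b | a b. a \<in> sumset_pow U n \<and> b \<in> U}"

lemma exponent_upset_sumset:
  assumes "exponent_upset V"
  shows "exponent_upset {a + b | a b. a \<in> U \<and> b \<in> V}"
  unfolding exponent_upset_def
proof clarify
  fix a b c assume "a \<in> U" "b \<in> V"
  then show "\<exists>a' b'. a + b + c = a' + b' \<and> a' \<in> U \<and> b' \<in> V"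
    using exponent_upsetD[OF assms, of b c] by (metis add.assoc)
qed

lemma exponent_upset_sumset_pow: "exponent_upset U \<Longrightarrow> exponent_upset (sumset_pow U n)"
proof (cases n)
  case 0
  then show ?thesis by (simp add: exponent_upset_def)
next
  case (Suc m)
  assume "exponent_upset U"
  then show ?thesis unfolding Suc sumset_pow.simps by (rule exponent_upset_sumset)
qed

lemma ideal_pow_monomial_span:
  assumes "exponent_upset U"
  shows "ideal_pow mpoly_ring (monomial_span U) m =
           (monomial_span (sumset_pow U m) :: ('v::finite, 'k::field) mpoly set)"
proof (induction m)
  case 0
  show ?case by (simp add: nat_pow_def ideals_set_def monomial_span_def)
next
  case (Suc m)
  have "ideal_pow mpoly_ring (monomial_span U) (Suc m) =
          ideal_prod mpoly_ring (ideal_pow mpoly_ring (monomial_span U) m) (monomial_span U :: ('v, 'k) mpoly set)"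
    by (simp add: nat_pow_def ideals_set_def)
  also have "\<dots> = monomial_span (sumset_pow U (Suc m))"
    unfolding Suc.IH sumset_pow.simps
    by (rule ideal_prod_monomial_span[OF exponent_upset_sumset_pow[OF assms] assms])
  finally show ?case .
qed

lemma sumset_powE:
  assumes "a \<in> sumset_pow U m"
  obtains u b where "\<And>j. j < m \<Longrightarrow> b j \<in> U" "a = u + (\<Sum>j<m. b j)"
  using assms
proof (induction m arbitrary: a thesis)
  case 0
  then show ?case by (metis add.right_neutral lessThan_0 not_less_zero sum.empty)
next
  case (Suc m)
  obtain x y where xy: "a = x + y" "x \<in> sumset_pow U m" "y \<in> U" using Suc.prems(2) by auto
  obtain u b where b: "\<And>j. j < m \<Longrightarrow> b j \<in> U" "x = u + (\<Sum>j<m. b j)" using Suc.IH xy(2) by blast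
  have "a = u + (\<Sum>j<Suc m. (b(m := y)) j)" using xy b(2) by (simp add: add.assoc)
  moreover have "(b(m := y)) j \<in> U" if "j < Suc m" for j using b(1)[of j] xy(3) that by auto
  ultimately show ?case using Suc.prems(1)[of "b(m := y)" u] by blast
qed

lemma sumset_pow_multiple:
  assumes "g \<in> U"
  shows "u + (\<Sum>j<m. g) \<in> sumset_pow U m"
proof (induction m)
  case (Suc m)
  have "u + (\<Sum>j<Suc m. g) = (u + (\<Sum>j<m. g)) + g" by (simp add: add.assoc)
  with Suc assms show ?case unfolding sumset_pow.simps by blast
qed simp

lemma max_ideal_eq_span:
  "(max_ideal :: ('v::finite, 'k::field) mpoly set) = monomial_span (- {0})"
proof -
  have "range (mvar :: 'v \<Rightarrow> ('v, 'k) mpoly) = mon ` range (\<lambda>i. Poly_Mapping.single i 1)"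
    by (auto simp: mvar_def)
  moreover have "{b + c | b c. b \<in> range (\<lambda>i::'v. Poly_Mapping.single i (1::nat))} = - {0}"
  proof (intro equalityI subsetI)
    fix a :: "'v \<Rightarrow>\<^sub>0 nat" assume "a \<in> - {0}"
    then have "a \<noteq> 0" by simp
    then obtain i b where "a = Poly_Mapping.single i 1 + b" by (rule exponent_neq_0E)
    then show "a \<in> {b + c | b c. b \<in> range (\<lambda>i::'v. Poly_Mapping.single i (1::nat))}"
      by blast
  next
    fix a :: "'v \<Rightarrow>\<^sub>0 nat" assume "a \<in> {b + c | b c. b \<in> range (\<lambda>i::'v. Poly_Mapping.single i (1::nat))}"
    then have "mon_deg a \<noteq> 0" by (auto simp del: mon_deg_eq_0_iff)
    then show "a \<in> - {0}" by auto
  qed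
  ultimately show ?thesis unfolding max_ideal_def by (simp only: genideal_mon)
qed

lemma exponent_upset_nonzero: "exponent_upset (- {0})"
  by (simp add: exponent_upset_def flip: mon_deg_eq_0_iff)

text \<open>Peeling off one variable \<open>N\<close> times leaves an arbitrary rest, so a degree
  bound suffices for membership in a power of the maximal ideal.\<close>

lemma sumset_pow_nonzero: "mon_deg a \<ge> N \<Longrightarrow> a \<in> sumset_pow (- {0}) N"
proof (induction N arbitrary: a)
  case (Suc N)
  then have "a \<noteq> 0" by auto
  then obtain i b where b: "a = Poly_Mapping.single i 1 + b" by (rule exponent_neq_0E)
  then have "b \<in> sumset_pow (- {0}) N" using Suc by simp
  moreover have "Poly_Mapping.single i (1::nat) \<in> - {0}" by (simp flip: mon_deg_eq_0_iff)
  ultimately show ?case using b by (auto simp: add.commute)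
qed simp

section \<open>Monomial primes and saturation\<close>

text \<open>Lexicographic minimisation: on restricting to the minimisers of \<open>l\<close> in
  \<open>A\<close> and in \<open>B\<close>, equality of the sums forces equality of \<open>l\<close>
  in each summand. With the coordinates as \<open>ls\<close> this does the work of a monomial
  order.\<close>

lemma exists_unique_sum:
  fixes ls :: "('e::ab_semigroup_add \<Rightarrow> nat) list"
  assumes "finite A" "A \<noteq> {}" "finite B" "B \<noteq> {}"
    and "\<And>l a b. l \<in> set ls \<Longrightarrow> l (a + b) = l a + l b"
  shows "\<exists>a\<in>A. \<exists>b\<in>B. \<forall>a'\<in>A. \<forall>b'\<in>B. a' + b' = a + b \<longrightarrow> (\<forall>l\<in>set ls. l a' = l a)"
  using assms
proof (induction ls arbitrary: A B)
  case Nil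
  then show ?case by auto
next
  case (Cons l ls)
  define A' B' where "A' = {a \<in> A. l a = Min (l ` A)}" and "B' = {b \<in> B. l b = Min (l ` B)}"
  have "Min (l ` A) \<in> l ` A" "Min (l ` B) \<in> l ` B" using Cons.prems by (auto intro!: Min_in)
  then have ne: "A' \<noteq> {}" "B' \<noteq> {}" by (force simp: A'_def B'_def)+
  have "finite A'" "finite B'" using Cons.prems by (auto simp: A'_def B'_def)
  with ne obtain a b where ab: "a \<in> A'" "b \<in> B'"
    "\<forall>a'\<in>A'. \<forall>b'\<in>B'. a' + b' = a + b \<longrightarrow> (\<forall>l\<in>set ls. l a' = l a)"
    using Cons.IH[of A' B'] Cons.prems by auto
  have *: "\<forall>k\<in>set (l # ls). k a' = k a" if "a' \<in> A" "b' \<in> B" "a' + b' = a + b" for a' b'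
  proof -
    have "l a' + l b' = l a + l b" using that Cons.prems(5) by (metis list.set_intros(1))
    moreover have "l a \<le> l a'" "l b \<le> l b'"
      using ab that Cons.prems by (auto simp: A'_def B'_def)
    ultimately have "l a' = l a" "l b' = l b" by auto
    moreover from this have "a' \<in> A'" "b' \<in> B'" using ab that by (auto simp: A'_def B'_def)
    ultimately show ?thesis using ab that by auto
  qed
  have "a \<in> A" "b \<in> B" using ab by (auto simp: A'_def B'_def)
  with * show ?case by blast
qed

text \<open>The ideal generated by the variables in \<open>S\<close>.\<close>

definition variable_prime :: "'v set \<Rightarrow> ('v::finite, 'k::field) mpoly set" where
  "variable_prime S = monomial_span (- exponents_in (- S))"

lemma exponent_upset_variable_prime: "exponent_upset (- exponents_in T)"
  by (auto simp: exponent_upset_def exponents_in_iff lookup_add)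

text \<open>
  The coefficient of \<open>s * f\<close> at \<open>t + b\<close> does not vanish if \<open>t\<close>, \<open>b\<close> are lexicographically
  minimal among the exponents of \<open>s\<close> free of the variables in \<open>S\<close>, respectively among the bad
  exponents of \<open>f\<close> of minimal degree in the variables in \<open>S\<close>.
\<close>

lemma exponents_of_saturation:
  fixes s f :: "('v::finite, 'k::field) mpoly"
  assumes U: "exponent_upset U" and s: "s \<notin> variable_prime S" and sf: "s * f \<in> monomial_span U"
    and a: "a \<in> Poly_Mapping.keys f"
  shows "\<exists>t\<in>exponents_in (- S). a + t \<in> U"
proof (rule ccontr)
  assume no: "\<not> ?thesis"
  define degS where "degS a = (\<Sum>i\<in>S. Poly_Mapping.lookup a i)" for a :: "'v \<Rightarrow>\<^sub>0 nat"
  have degS_add: "degS (b + c) = degS b + degS c" for b c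
    by (simp add: degS_def lookup_add sum.distrib)
  have degS_0: "degS b = 0 \<longleftrightarrow> b \<in> exponents_in (- S)" for b
    by (auto simp: degS_def exponents_in_iff)
  define A where "A = {t \<in> Poly_Mapping.keys s. t \<in> exponents_in (- S)}"
  define W where "W = {b \<in> Poly_Mapping.keys f. \<forall>t\<in>exponents_in (- S). b + t \<notin> U}"
  define B where "B = {b \<in> W. degS b = Min (degS ` W)}"
  have A: "finite A" "A \<noteq> {}"
    using s by (auto simp: A_def variable_prime_def monomial_span_def)
  have W: "finite W" "W \<noteq> {}" using a no by (auto simp: W_def)
  then have "Min (degS ` W) \<in> degS ` W" by (intro Min_in) auto
  then have B: "finite B" "B \<noteq> {}" using W(1) by (force simp: B_def)+
  obtain vs :: "'v list" where vs: "set vs = UNIV" using finite_list[of "UNIV :: 'v set"] by auto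
  obtain t b where tb: "t \<in> A" "b \<in> B"
    "\<forall>t'\<in>A. \<forall>b'\<in>B. t' + b' = t + b \<longrightarrow>
        (\<forall>l\<in>set (map (\<lambda>i a. Poly_Mapping.lookup a i) vs). l t' = l t)"
  proof -
    have "l (a + b) = l a + l b" if "l \<in> set (map (\<lambda>i a. Poly_Mapping.lookup a i) vs)"
      for l and a b :: "'v \<Rightarrow>\<^sub>0 nat"
      using that by (auto simp: lookup_add)
    from exists_unique_sum[OF A B, of "map (\<lambda>i a. Poly_Mapping.lookup a i) vs", OF this]
    show ?thesis using that by blast
  qed
  have t: "t \<in> Poly_Mapping.keys s" "t \<in> exponents_in (- S)" using tb by (auto simp: A_def)
  have b: "b \<in> Poly_Mapping.keys f" "b \<in> W" using tb by (auto simp: B_def W_def)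
  have "Poly_Mapping.lookup (s * f) (t + b) = Poly_Mapping.lookup s t * Poly_Mapping.lookup f b"
  proof (rule lookup_mult_unique[OF t(1) b(1)])
    fix t' b' assume t': "t' \<in> Poly_Mapping.keys s" and b': "b' \<in> Poly_Mapping.keys f" and eq: "t' + b' = t + b"
    \<comment> \<open>Were \<open>b'\<close> moved into \<open>U\<close> by \<open>x\<close>, then
      adding \<open>t'\<close> and using \<open>t' + b' = t + b\<close> would show that
      \<open>t + x\<close>, again free of \<open>S\<close>, moves \<open>b\<close> into
      \<open>U\<close>.\<close>
    have "b' \<in> W"
    proof (rule ccontr)
      assume "b' \<notin> W"
      then obtain x where x: "x \<in> exponents_in (- S)" "b' + x \<in> U" using b' by (auto simp: W_def)
      have "b' + x + t' = (t' + b') + x" by (simp only: add_ac)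
      also have "\<dots> = b + (t + x)" unfolding eq by (simp only: add_ac)
      finally have "b + (t + x) \<in> U" using exponent_upsetD[OF U x(2), of t'] by simp
      moreover have "t + x \<in> exponents_in (- S)" using t x by (intro exponents_in_add)
      ultimately show False using b(2) by (auto simp: W_def)
    qed
    \<comment> \<open>As \<open>degS t = 0\<close> and \<open>degS b\<close> is minimal on
      \<open>W\<close>, equality of the sums places \<open>t'\<close> in \<open>A\<close> and
      \<open>b'\<close> in \<open>B\<close>, where the lexicographic choice applies.\<close>
    then have "Min (degS ` W) \<le> degS b'" using W by auto
    then have "degS b \<le> degS b'" using tb by (simp add: B_def)
    moreover have "degS t' + degS b' = degS t + degS b" using eq by (metis degS_add)
    moreover have "degS t = 0" using t degS_0 by blast
    ultimately have "degS t' = 0" "degS b' = degS b" by auto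
    then have "t' \<in> A" "b' \<in> B" using t' \<open>b' \<in> W\<close> tb degS_0 by (auto simp: A_def B_def)
    then have "\<forall>l\<in>set (map (\<lambda>i a. Poly_Mapping.lookup a i) vs). l t' = l t" using tb eq by blast
    then have "t' = t" by (intro poly_mapping_eqI) (simp add: vs)
    then show "t' = t \<and> b' = b" using eq by simp
  qed
  then have "t + b \<in> Poly_Mapping.keys (s * f)" using t b by (simp add: in_keys_iff)
  then have "b + t \<in> U" using sf by (auto simp: monomial_span_def add.commute)
  then show False using b t by (auto simp: W_def)
qed

text \<open>Saturation with the prime itself as target: if \<open>x\<close> lies outside, each
  exponent of \<open>y\<close> meets \<open>S\<close> after adding some \<open>t\<close> free of
  \<open>S\<close>, so it meets \<open>S\<close> already.\<close>

lemma primeideal_variable_prime: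
  "primeideal (variable_prime S :: ('v::finite, 'k::field) mpoly set) mpoly_ring"
  unfolding primeideal_type_algebra_iff
proof (intro conjI allI impI)
  show "ideal (variable_prime S :: ('v, 'k) mpoly set) mpoly_ring"
    unfolding variable_prime_def by (rule ideal_monomial_span[OF exponent_upset_variable_prime])
  show "(1 :: ('v, 'k) mpoly) \<notin> variable_prime S"
    by (simp add: variable_prime_def flip: mon_0)
  fix x y :: "('v, 'k) mpoly" assume xy: "x * y \<in> variable_prime S"
  have "y \<in> variable_prime S" if x: "x \<notin> variable_prime S"
    unfolding variable_prime_def monomial_span_def
  proof clarify
    fix a assume a: "a \<in> Poly_Mapping.keys y" "a \<in> exponents_in (- S)"
    obtain t where "t \<in> exponents_in (- S)" "a + t \<in> - exponents_in (- S)"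
      using exponents_of_saturation[OF exponent_upset_variable_prime x _ a(1)] xy
      unfolding variable_prime_def by blast
    then show False using a exponents_in_add by auto
  qed
  then show "x \<in> variable_prime S \<or> y \<in> variable_prime S" by blast
qed

lemma mvar_in_variable_prime [simp]:
  "(mvar i :: ('v::finite, 'k::field) mpoly) \<in> variable_prime S \<longleftrightarrow> i \<in> S"
  by (auto simp: mvar_def variable_prime_def exponents_in_iff lookup_single when_def)

lemma variable_prime_mono: "S \<subseteq> T \<Longrightarrow> variable_prime S \<subseteq> variable_prime T"
  unfolding variable_prime_def monomial_span_def
  using exponents_in_mono[of "- T" "- S"] by auto

text \<open>Adding the variables of \<open>S\<close> one at a time gives a strict chain of primes
  starting at the zero ideal.\<close>

lemma card_le_height_variable_prime:
  "enat (card S) \<le> height mpoly_ring (variable_prime S :: ('v::finite, 'k::field) mpoly set)"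
proof -
  obtain vs where vs: "set vs = S" "distinct vs" using finite_distinct_list[of S] by auto
  define c where "c i = (variable_prime (set (take i vs)) :: ('v, 'k) mpoly set)" for i
  have "c i \<subset> c (Suc i)" if "i < card S" for i
  proof -
    have i: "i < length vs" using that vs distinct_card by force
    have "c i \<subseteq> c (Suc i)" unfolding c_def by (intro variable_prime_mono set_take_subset_set_take) simp
    moreover have "vs ! i \<in> set (take (Suc i) vs)" using i by (simp add: take_Suc_conv_app_nth)
    moreover have "vs ! i \<notin> set (take i vs)"
      using i vs(2) by (auto simp: in_set_conv_nth nth_eq_iff_index_eq)
    ultimately show ?thesis unfolding c_def by (metis mvar_in_variable_prime psubsetI)
  qed
  moreover have "c (card S) = variable_prime S"
    using vs distinct_card[OF vs(2)] by (simp add: c_def)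
  moreover have "primeideal (c i) mpoly_ring" for i
    unfolding c_def by (rule primeideal_variable_prime)
  ultimately show ?thesis
    unfolding height_def by (intro Sup_upper) blast
qed

text \<open>A prime that contains a monomial contains one of the variables dividing it.\<close>

lemma primeideal_mon_notin:
  fixes P :: "('v::finite, 'k::field) mpoly set"
  assumes P: "primeideal P mpoly_ring" and t: "t \<in> exponents_in (- {i. mvar i \<in> P})"
  shows "mon t \<notin> P"
  using t
proof (induction "mon_deg t" arbitrary: t)
  case 0
  then show ?case using P by (simp add: mon_0 primeideal_type_algebra_iff)
next
  case (Suc n)
  then have "t \<noteq> 0" by auto
  then obtain i b where b: "t = Poly_Mapping.single i 1 + b" by (rule exponent_neq_0E)
  have "n = mon_deg b" using Suc.hyps(2) b by simp
  moreover have "b \<in> exponents_in (- {i. mvar i \<in> P})"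
    using Suc.prems b by (auto simp: exponents_in_iff lookup_add)
  ultimately have "mon b \<notin> P" using Suc.hyps(1) by blast
  moreover have "Poly_Mapping.lookup t i \<noteq> 0" by (simp add: b lookup_add)
  then have "mvar i \<notin> P" using Suc.prems by (auto simp: exponents_in_iff)
  ultimately show ?case
    using P unfolding b mon_add mvar_def primeideal_type_algebra_iff by blast
qed

text \<open>Together with \<open>primeideal_mon_notin\<close> this says that both primes contain the
  same monomials, so for monomial ideals localising at \<open>P\<close> depends only on the
  variables in \<open>P\<close>.\<close>

lemma variable_prime_subset_primeideal:
  fixes P :: "('v::finite, 'k::field) mpoly set"
  assumes P: "primeideal P mpoly_ring"
  shows "variable_prime {i. mvar i \<in> P} \<subseteq> P"
  unfolding variable_prime_def
proof (rule monomial_span_subset_ideal)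
  show I: "ideal P mpoly_ring" using P by (simp add: primeideal_type_algebra_iff)
  fix a assume "a \<in> - exponents_in (- {i. (mvar i :: ('v, 'k) mpoly) \<in> P})"
  then obtain i where i: "mvar i \<in> P" "Poly_Mapping.lookup a i \<noteq> 0"
    by (auto simp: exponents_in_iff)
  from i(2) obtain b where "a = Poly_Mapping.single i 1 + b" by (rule exponent_nonzeroE)
  then have "mon a = mon b * (mvar i :: ('v, 'k) mpoly)" by (simp add: mon_add mvar_def mult.commute)
  then show "mon a \<in> P" using I i(1) by (simp add: ideal_type_algebra_iff)
qed

text \<open>The sum of the multipliers of the single terms serves all terms at once, because
  \<open>U\<close> is an upset.\<close>

lemma mon_common_multiplier:
  fixes f :: "('v::finite, 'k::field) mpoly"
  assumes U: "exponent_upset U" and f: "\<And>a. a \<in> Poly_Mapping.keys f \<Longrightarrow> \<exists>t\<in>exponents_in T. a + t \<in> U"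
  obtains t where "t \<in> exponents_in T" "mon t * f \<in> monomial_span U"
proof -
  obtain h where h: "\<And>a. a \<in> Poly_Mapping.keys f \<Longrightarrow> h a \<in> exponents_in T \<and> a + h a \<in> U"
    using f by metis
  define t where "t = (\<Sum>a\<in>Poly_Mapping.keys f. h a)"
  have "t + a \<in> U" if a: "a \<in> Poly_Mapping.keys f" for a
  proof -
    have "t = h a + (\<Sum>a\<in>Poly_Mapping.keys f - {a}. h a)"
      unfolding t_def using a by (simp add: sum.remove)
    then have "t + a = (a + h a) + (\<Sum>a\<in>Poly_Mapping.keys f - {a}. h a)"
      by (simp add: add_ac)
    then show ?thesis using exponent_upsetD[OF U] h[OF a] by simp
  qed
  then have "mon t * f \<in> monomial_span U"
    using keys_mult[of "mon t" f] by (fastforce simp: monomial_span_def)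
  moreover have "t \<in> exponents_in T"
    unfolding t_def using h by (intro exponents_in_sum) auto
  ultimately show ?thesis using that by blast
qed

text \<open>Localising sets the variables outside \<open>P\<close> to 1. A denominator outside
  \<open>P\<close> is also outside the variable prime below \<open>P\<close>, so saturation applies;
  conversely a monomial free of the variables in \<open>P\<close> is an admissible
  denominator.\<close>

lemma loc_contract_monomial_span:
  fixes P :: "('v::finite, 'k::field) mpoly set"
  assumes P: "primeideal P mpoly_ring" and U: "exponent_upset U"
  shows "loc_contract mpoly_ring P (monomial_span U) =
           monomial_span {a. \<exists>t\<in>exponents_in (- {i. (mvar i :: ('v, 'k) mpoly) \<in> P}). a + t \<in> U}"
    (is "?L = ?R")
proof -
  have L: "?L = {f. \<exists>s. s \<notin> P \<and> s * f \<in> monomial_span U}"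
    using P by (intro loc_contract_eq ideal_monomial_span U) (auto simp: primeideal_type_algebra_iff)
  show ?thesis
  proof (intro equalityI subsetI)
    fix f assume "f \<in> ?L"
    then obtain s where s: "s \<notin> P" "s * f \<in> monomial_span U" unfolding L by blast
    then have "s \<notin> variable_prime {i. mvar i \<in> P}" using variable_prime_subset_primeideal[OF P] by blast
    then show "f \<in> ?R"
      using exponents_of_saturation[OF U _ s(2)] by (auto simp: monomial_span_def)
  next
    fix f assume "f \<in> ?R"
    then have "\<exists>t\<in>exponents_in (- {i. (mvar i :: ('v, 'k) mpoly) \<in> P}). a + t \<in> U"
      if "a \<in> Poly_Mapping.keys f" for a
      using that by (auto simp: monomial_span_def)
    then obtain t where "t \<in> exponents_in (- {i. (mvar i :: ('v, 'k) mpoly) \<in> P})" "mon t * f \<in> monomial_span U"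
      using mon_common_multiplier[OF U] by blast
    then show "f \<in> ?L" unfolding L using primeideal_mon_notin[OF P] by blast
  qed
qed

text \<open>\<open>P\<close> is the colon ideal of some \<open>f\<close>. If some \<open>g\<close>
  in \<open>P\<close> were outside the variable prime, saturation would give a monomial outside
  \<open>P\<close> that multiplies \<open>f\<close> into the ideal and hence lies in
  \<open>P\<close>.\<close>

lemma associated_prime_of_monomial_span:
  fixes P :: "('v::finite, 'k::field) mpoly set"
  assumes U: "exponent_upset U" and P: "P \<in> Ass mpoly_ring (monomial_span U)"
  shows "P = variable_prime {i. mvar i \<in> P}"
proof
  obtain f where prime: "primeideal P mpoly_ring" and f: "P = {g. g * f \<in> monomial_span U}"
    using P by (auto simp: Ass_def)
  show "variable_prime {i. mvar i \<in> P} \<subseteq> P" by (rule variable_prime_subset_primeideal[OF prime])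
  show "P \<subseteq> variable_prime {i. mvar i \<in> P}"
  proof (rule ccontr)
    assume "\<not> ?thesis"
    then obtain g where g: "g \<in> P" "g \<notin> variable_prime {i. mvar i \<in> P}" by blast
    then have "\<exists>t\<in>exponents_in (- {i. (mvar i :: ('v, 'k) mpoly) \<in> P}). a + t \<in> U" if "a \<in> Poly_Mapping.keys f" for a
      using exponents_of_saturation[OF U g(2) _ that] f by blast
    then obtain t where "t \<in> exponents_in (- {i. (mvar i :: ('v, 'k) mpoly) \<in> P})" "mon t * f \<in> monomial_span U"
      using mon_common_multiplier[OF U] by blast
    then show False using primeideal_mon_notin[OF prime] f by blast
  qed
qed

section \<open>Associated primes of monomial ideals\<close>

text \<open>Makes the colon ideal of a multiple of \<open>x^c\<close> a variable prime.
  \<open>T\<close> is a maximal set of variables whose monomials all keep some multiple of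
  \<open>x^c\<close> outside the ideal, and \<open>S\<close> is its complement; the multiple is then
  enlarged until every variable in \<open>S\<close> sends it into the ideal.\<close>

lemma exists_variable_colon:
  fixes U :: "('v::finite \<Rightarrow>\<^sub>0 nat) set"
  assumes U: "exponent_upset U" and c: "c \<notin> U"
  obtains S d where "\<And>t. t \<in> exponents_in (- S) \<Longrightarrow> c + d + t \<notin> U"
    and "\<And>i. i \<in> S \<Longrightarrow> c + d + Poly_Mapping.single i 1 \<in> U"
proof -
  define Q where "Q T \<longleftrightarrow> (\<exists>d. \<forall>t\<in>exponents_in T. c + d + t \<notin> U)" for T
  have "t = 0" if "t \<in> exponents_in {}" for t :: "'v \<Rightarrow>\<^sub>0 nat"
    using that by (intro poly_mapping_eqI) (simp add: exponents_in_iff)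
  then have "Q {}" using c unfolding Q_def by (metis add.right_neutral)
  then obtain T where T: "Q T" and T_max: "\<And>T'. Q T' \<Longrightarrow> T \<subseteq> T' \<Longrightarrow> T' = T"
    using finite_has_maximal[of "{T. Q T}"] by auto
  then obtain d where d: "\<And>t. t \<in> exponents_in T \<Longrightarrow> c + d + t \<notin> U" unfolding Q_def by blast
  have ex: "\<exists>t\<in>exponents_in (insert i T). c + x + t \<in> U" if "i \<notin> T" for i x
    using T_max[of "insert i T"] that unfolding Q_def by blast
  from ex[of _ d] have "\<forall>i. \<exists>t. i \<notin> T \<longrightarrow> t \<in> exponents_in (insert i T) \<and> c + d + t \<in> U" by blast
  then obtain h where h: "\<And>i. i \<notin> T \<Longrightarrow> h i \<in> exponents_in (insert i T) \<and> c + d + h i \<in> U"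
    by metis
  define G where "G u \<longleftrightarrow> u \<in> exponents_in (- T) \<and> (\<forall>t\<in>exponents_in T. c + (d + u) + t \<notin> U)" for u
  \<comment> \<open>By maximality of \<open>T\<close>, \<open>h i\<close> moves \<open>c + d\<close>
    into \<open>U\<close>. If \<open>u\<close> had more of the variable \<open>i\<close> than
    \<open>h i\<close>, it would absorb the part of \<open>h i\<close> outside \<open>T\<close>, a
    power of that variable, and the rest \<open>x\<close> over \<open>T\<close> would contradict
    \<open>G u\<close>.\<close>
  have bound: "Poly_Mapping.lookup u i \<le> Poly_Mapping.lookup (h i) i" if u: "G u" for u i
  proof (cases "i \<in> T")
    case True
    then show ?thesis using u by (simp add: G_def exponents_in_iff)
  next
    case False
    show ?thesis
    proof (rule ccontr)
      assume less: "\<not> ?thesis"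
      obtain x y where xy: "h i = x + y" "x \<in> exponents_in T" "y \<in> exponents_in (- T)"
        by (rule exponents_in_split)
      have "Poly_Mapping.lookup y j \<le> Poly_Mapping.lookup u j" for j
      proof (cases "j = i")
        case True
        then show ?thesis using less xy by (simp add: lookup_add)
      next
        case False
        have "Poly_Mapping.lookup y j = 0"
        proof (cases "j \<in> T")
          case True
          then show ?thesis using xy(3) by (simp add: exponents_in_iff)
        next
          case j: False
          then have "Poly_Mapping.lookup (h i) j = 0"
            using h[OF \<open>i \<notin> T\<close>] False by (simp add: exponents_in_iff)
          then show ?thesis using xy(1) by (simp add: lookup_add)
        qed
        then show ?thesis by simp
      qed
      then obtain z where z: "u = y + z" using exponent_le_iff[of y u] by blast
      have "c + (d + u) + x = (c + d + h i) + z" by (simp add: z xy(1) add_ac)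
      then have "c + (d + u) + x \<in> U" using exponent_upsetD[OF U] h[OF \<open>i \<notin> T\<close>] by simp
      then show False using u xy(2) unfolding G_def by blast
    qed
  qed
  have "G 0" using d by (simp add: G_def)
  moreover have "\<forall>u. G u \<longrightarrow> mon_deg u < Suc (\<Sum>i\<in>UNIV. Poly_Mapping.lookup (h i) i)"
    unfolding mon_deg_def using bound by (auto simp: less_Suc_eq_le intro!: sum_mono)
  ultimately have "\<exists>u. G u \<and> (\<forall>u'. G u' \<longrightarrow> mon_deg u' \<le> mon_deg u)"
    by (rule Lattices_Big.ex_has_greatest_nat)
  \<comment> \<open>For \<open>u\<close> of greatest degree, one more variable \<open>i\<close>
    outside \<open>T\<close> violates \<open>G\<close>, so some \<open>k i\<close> over
    \<open>T\<close> then leads into \<open>U\<close>.\<close>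
  then obtain u where u: "G u" and u_max: "\<And>u'. G u' \<Longrightarrow> mon_deg u' \<le> mon_deg u" by blast
  have "\<exists>t\<in>exponents_in T. c + (d + u) + Poly_Mapping.single i 1 + t \<in> U" if i: "i \<notin> T" for i
  proof -
    have "\<not> G (u + Poly_Mapping.single i 1)" using u_max[of "u + Poly_Mapping.single i 1"] by auto
    moreover have "u + Poly_Mapping.single i 1 \<in> exponents_in (- T)"
      using u i by (auto simp: G_def exponents_in_iff lookup_add lookup_single when_def)
    ultimately show ?thesis by (auto simp: G_def add_ac)
  qed
  then obtain k where k: "\<And>i. i \<notin> T \<Longrightarrow> k i \<in> exponents_in T \<and> c + (d + u) + Poly_Mapping.single i 1 + k i \<in> U"
    by metis
  \<comment> \<open>Adding all \<open>k i\<close> at once makes each variable outside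
    \<open>T\<close> lead into \<open>U\<close> directly; since \<open>w\<close> involves only
    \<open>T\<close>, it does not enter \<open>U\<close> itself.\<close>
  define w where "w = (\<Sum>i\<in>- T. k i)"
  have w: "w \<in> exponents_in T" unfolding w_def using k by (intro exponents_in_sum) auto
  show ?thesis
  proof (rule that[of "- T" "d + u + w"])
    fix t assume "t \<in> exponents_in (- (- T))"
    then have "w + t \<in> exponents_in T" using w exponents_in_add by auto
    then have "c + (d + u) + (w + t) \<notin> U" using u unfolding G_def by blast
    then show "c + (d + u + w) + t \<notin> U" by (simp add: add_ac)
  next
    fix i assume i: "i \<in> - T"
    then have "w = k i + (\<Sum>j\<in>- T - {i}. k j)" unfolding w_def by (simp add: sum.remove)
    then have "c + (d + u + w) + Poly_Mapping.single i 1 =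
        (c + (d + u) + Poly_Mapping.single i 1 + k i) + (\<Sum>j\<in>- T - {i}. k j)" by (simp add: add_ac)
    then show "c + (d + u + w) + Poly_Mapping.single i 1 \<in> U"
      using exponent_upsetD[OF U] k i by simp
  qed
qed

text \<open>A monomial outside the ideal stays outside its localisation at some associated prime, so
  the ideal is recovered from these localisations. The prime is the colon ideal of
  \<open>x^(c + d)\<close>; since \<open>U\<close> is an upset, avoidance passes from
  \<open>c + d\<close> to \<open>c\<close>.\<close>

lemma exists_associated_variable_prime:
  fixes U :: "('v::finite \<Rightarrow>\<^sub>0 nat) set"
  assumes U: "exponent_upset U" and c: "c \<notin> U"
  obtains S where "(variable_prime S :: ('v, 'k::field) mpoly set) \<in> Ass mpoly_ring (monomial_span U)"
    and "\<And>t. t \<in> exponents_in (- S) \<Longrightarrow> c + t \<notin> U"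
proof -
  obtain S d where S: "\<And>t. t \<in> exponents_in (- S) \<Longrightarrow> c + d + t \<notin> U"
    and S': "\<And>i. i \<in> S \<Longrightarrow> c + d + Poly_Mapping.single i 1 \<in> U"
    using exists_variable_colon[OF U c] by blast
  have colon: "g * mon (c + d) \<in> monomial_span U \<longleftrightarrow> g \<in> variable_prime S" for g :: "('v, 'k) mpoly"
  proof
    assume g: "g * mon (c + d) \<in> monomial_span U"
    show "g \<in> variable_prime S"
    proof (rule ccontr)
      assume "g \<notin> variable_prime S"
      then have "\<exists>t\<in>exponents_in (- S). c + d + t \<in> U"
        using exponents_of_saturation[OF U _ g, of S "c + d"] by simp
      then show False using S by blast
    qed
  next
    have "a + (c + d) \<in> U" if "a \<notin> exponents_in (- S)" for a
    proof -
      obtain i where i: "i \<in> S" "Poly_Mapping.lookup a i \<noteq> 0" using \<open>a \<notin> _\<close> by (auto simp: exponents_in_iff)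
      from i(2) obtain b where "a = Poly_Mapping.single i 1 + b" by (rule exponent_nonzeroE)
      then have "a + (c + d) = (c + d + Poly_Mapping.single i 1) + b" by (simp add: add_ac)
      then show ?thesis using exponent_upsetD[OF U] S'[OF i(1)] by simp
    qed
    moreover assume "g \<in> variable_prime S"
    ultimately show "g * mon (c + d) \<in> monomial_span U"
      using keys_mult[of g "mon (c + d)"] by (fastforce simp: monomial_span_def variable_prime_def)
  qed
  have "(variable_prime S :: ('v, 'k) mpoly set) \<in> Ass mpoly_ring (monomial_span U)"
    unfolding Ass_def using primeideal_variable_prime colon by (auto intro!: exI[of _ "mon (c + d)"])
  moreover have "c + t \<notin> U" if "t \<in> exponents_in (- S)" for t
    using S[OF that] exponent_upsetD[OF U, of "c + t" d] by (auto simp: add_ac)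
  ultimately show ?thesis using that by blast
qed

lemma exists_small_associated_variable_prime:
  fixes U :: "('v::finite \<Rightarrow>\<^sub>0 nat) set"
  assumes U: "exponent_upset U" "U \<noteq> {}" and c: "c \<notin> U"
    and e: "big_height mpoly_ring (monomial_span U :: ('v, 'k::field) mpoly set) = enat e"
  obtains S where "(variable_prime S :: ('v, 'k) mpoly set) \<in> Ass mpoly_ring (monomial_span U)"
    and "S \<noteq> {}" and "card S \<le> e" and "\<And>t. t \<in> exponents_in (- S) \<Longrightarrow> c + t \<notin> U"
proof -
  obtain S where S: "(variable_prime S :: ('v, 'k) mpoly set) \<in> Ass mpoly_ring (monomial_span U)"
    and avoid: "\<And>t. t \<in> exponents_in (- S) \<Longrightarrow> c + t \<notin> U"
    using exists_associated_variable_prime[OF U(1) c] by blast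
  \<comment> \<open>If \<open>S\<close> were empty, every exponent would be admissible, and adding
    one from \<open>U\<close> puts \<open>c\<close> into \<open>U\<close>.\<close>
  have "S \<noteq> {}"
  proof
    assume "S = {}"
    moreover obtain u where "u \<in> U" using U(2) by blast
    ultimately show False
      using avoid[of u] exponent_upsetD[OF U(1), of u c] by (simp add: exponents_in_iff add.commute)
  qed
  have "enat (card S) \<le> height mpoly_ring (variable_prime S :: ('v, 'k) mpoly set)"
    by (rule card_le_height_variable_prime)
  also have "\<dots> \<le> enat e" unfolding e[symmetric] big_height_def using S by (rule SUP_upper)
  finally have "card S \<le> e" by simp
  with S \<open>S \<noteq> {}\<close> avoid show ?thesis using that by blast
qed

text \<open>Associated primes are variable primes, so there are finitely many, and an exponent
  outside \<open>U\<close> provides at least one.\<close>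

lemma maxAss_monomial_span_nonempty:
  fixes U :: "('v::finite \<Rightarrow>\<^sub>0 nat) set"
  assumes U: "exponent_upset U" and "U \<noteq> UNIV"
  shows "maxAss mpoly_ring (monomial_span U :: ('v, 'k::field) mpoly set) \<noteq> {}"
proof -
  let ?A = "Ass mpoly_ring (monomial_span U :: ('v, 'k) mpoly set)"
  have "?A \<subseteq> range variable_prime" using associated_prime_of_monomial_span[OF U] by blast
  then have "finite ?A" using finite_subset by fastforce
  moreover have "?A \<noteq> {}" using assms exists_associated_variable_prime[OF U] by (metis UNIV_eq_I empty_iff)
  ultimately obtain P where "P \<in> ?A" "\<forall>P'\<in>?A. P \<subseteq> P' \<longrightarrow> P = P'"
    using finite_has_maximal[of ?A] by blast
  then show ?thesis unfolding maxAss_def by blast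
qed

lemma floor_quotient_mem_of_symbolic_power:
  fixes U :: "('v::finite \<Rightarrow>\<^sub>0 nat) set" and f :: "('v, 'k::field) mpoly"
  assumes U: "exponent_upset U" "U \<noteq> {}"
    and e: "big_height mpoly_ring (monomial_span U :: ('v, 'k) mpoly set) = enat e" and r: "r > 0"
    and f: "f \<in> symbolic_power mpoly_ring (monomial_span U) (e * r)"
    and a: "a \<in> Poly_Mapping.keys f"
  shows "exponent_of (\<lambda>i. Poly_Mapping.lookup a i div r) \<in> U"
proof (rule ccontr)
  let ?c = "exponent_of (\<lambda>i. Poly_Mapping.lookup a i div r)"
  assume "?c \<notin> U"
  then obtain S where S: "(variable_prime S :: ('v, 'k) mpoly set) \<in> Ass mpoly_ring (monomial_span U)"
    and "S \<noteq> {}" and card: "card S \<le> e" and avoid: "\<And>t. t \<in> exponents_in (- S) \<Longrightarrow> ?c + t \<notin> U"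
    using exists_small_associated_variable_prime[OF U _ e] by blast
  have "f \<in> loc_contract mpoly_ring (variable_prime S) (monomial_span (sumset_pow U (e * r)))"
    using f S unfolding symbolic_power_def ideal_pow_monomial_span[OF U(1)] by blast
  then have "\<exists>t\<in>exponents_in (- S). a + t \<in> sumset_pow U (e * r)"
    unfolding loc_contract_monomial_span[OF primeideal_variable_prime exponent_upset_sumset_pow[OF U(1)]]
    using a by (auto simp: monomial_span_def)
  then obtain t where t: "t \<in> exponents_in (- S)" "a + t \<in> sumset_pow U (e * r)" by blast
  from t(2) obtain u b where b: "\<And>j. j < e * r \<Longrightarrow> b j \<in> U" "a + t = u + (\<Sum>j<e * r. b j)"
    by (rule sumset_powE) blast
  have "\<exists>j\<in>{..<e * r}. \<forall>i\<in>S. real r * real (Poly_Mapping.lookup (b j) i) \<le> real (Poly_Mapping.lookup a i)"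
  \<comment> \<open>Each of the \<open>e * r\<close> exponents gets weight 1; the total weight is at
    least \<open>card S * r\<close> because \<open>card S\<close> is at most
    \<open>e\<close>.\<close>
  proof (rule exists_heavy_vector[where w = "\<lambda>_. 1"])
    fix i assume i: "i \<in> S"
    have "Poly_Mapping.lookup a i = Poly_Mapping.lookup (a + t) i"
      using t i by (simp add: lookup_add exponents_in_iff)
    also have "\<dots> \<ge> (\<Sum>j<e * r. Poly_Mapping.lookup (b j) i)"
      unfolding b(2) by (simp add: lookup_add lookup_sum)
    finally show "(\<Sum>j<e * r. 1 * real (Poly_Mapping.lookup (b j) i)) \<le> real (Poly_Mapping.lookup a i)"
      by (simp flip: of_nat_sum)
  next
    show "real (card S) * real r \<le> (\<Sum>j<e * r. 1)"
      using card by (simp add: mult_right_mono)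
  qed (use \<open>S \<noteq> {}\<close> r in auto)
  then obtain j where j: "j < e * r" "\<And>i. i \<in> S \<Longrightarrow> r * Poly_Mapping.lookup (b j) i \<le> Poly_Mapping.lookup a i"
    unfolding of_nat_mult[symmetric] of_nat_le_iff by blast
  \<comment> \<open>The floor dominates \<open>b j\<close> only on \<open>S\<close>; the part
    \<open>y\<close> outside \<open>S\<close> is a unit at the prime and is added as the multiplier
    that \<open>avoid\<close> forbids.\<close>
  obtain x y where xy: "b j = x + y" "x \<in> exponents_in S" "y \<in> exponents_in (- S)"
    by (rule exponents_in_split)
  have "Poly_Mapping.lookup (b j) i \<le> Poly_Mapping.lookup (?c + y) i" for i
  proof (cases "i \<in> S")
    case True
    then have "Poly_Mapping.lookup (b j) i \<le> Poly_Mapping.lookup a i div r"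
      using j(2) r by (simp add: less_eq_div_iff_mult_less_eq mult.commute)
    then show ?thesis by (simp add: lookup_add)
  next
    case False
    then show ?thesis using xy by (simp add: lookup_add exponents_in_iff)
  qed
  then obtain z where "?c + y = b j + z" using exponent_le_iff[of "b j" "?c + y"] by blast
  then have "?c + y \<in> U" using exponent_upsetD[OF U(1) b(1)[OF j(1)]] by simp
  then show False using avoid[OF xy(3)] by blast
qed

section \<open>The symbolic polyhedron\<close>

lemma real_vec_sum: "real_vec (sum f A) = (\<Sum>x\<in>A. real_vec (f x))"
  by (simp add: real_vec_def vec_eq_iff lookup_sum)

text \<open>At each maximal associated prime, \<open>a\<close> is a sum of \<open>m\<close>
  exponents of the localised ideal, so \<open>a / m\<close> is their average and lies in the convex
  hull.\<close>

lemma real_vec_quotient_mem_symbolic_polyhedron: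
  fixes U :: "('v::finite \<Rightarrow>\<^sub>0 nat) set" and f :: "('v, 'k::field) mpoly"
  assumes U: "exponent_upset U" and m: "m > 0"
    and f: "f \<in> symbolic_power mpoly_ring (monomial_span U) m"
    and a: "a \<in> Poly_Mapping.keys f"
  shows "real_vec a /\<^sub>R real m \<in> symbolic_polyhedron (monomial_span U :: ('v, 'k) mpoly set)"
  unfolding symbolic_polyhedron_def
proof (rule INT_I)
  fix P :: "('v, 'k) mpoly set" assume "P \<in> maxAss mpoly_ring (monomial_span U)"
  then have P: "P \<in> Ass mpoly_ring (monomial_span U)" by (simp add: maxAss_def)
  then have prime: "primeideal P mpoly_ring" by (simp add: Ass_def)
  define S where "S = {i. (mvar i :: ('v, 'k) mpoly) \<in> P}"
  define V where "V = {b. \<exists>t\<in>exponents_in (- S). b + t \<in> U}"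
  have V: "exponents (loc_contract mpoly_ring P (monomial_span U)) = V"
    unfolding loc_contract_monomial_span[OF prime U] by (simp add: V_def S_def)
  have "f \<in> loc_contract mpoly_ring P (monomial_span (sumset_pow U m))"
    using f P unfolding symbolic_power_def ideal_pow_monomial_span[OF U] by blast
  then have "\<exists>t\<in>exponents_in (- S). a + t \<in> sumset_pow U m"
    using a unfolding loc_contract_monomial_span[OF prime exponent_upset_sumset_pow[OF U]]
    by (auto simp: monomial_span_def S_def)
  then obtain t where t: "t \<in> exponents_in (- S)" "a + t \<in> sumset_pow U m" by blast
  from t(2) obtain u b where b: "\<And>j. j < m \<Longrightarrow> b j \<in> U" "a + t = u + (\<Sum>j<m. b j)"
    by (rule sumset_powE) blast
  have "\<exists>x y. b j = x + y \<and> x \<in> exponents_in S \<and> y \<in> exponents_in (- S)" for j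
    by (rule exponents_in_split[of "b j" S]) blast
  then obtain x y where xy: "\<And>j. b j = x j + y j" "\<And>j. x j \<in> exponents_in S" "\<And>j. y j \<in> exponents_in (- S)"
    by metis
  have "Poly_Mapping.lookup (\<Sum>j<m. x j) i \<le> Poly_Mapping.lookup a i" for i
  proof (cases "i \<in> S")
    case True
    have "Poly_Mapping.lookup (\<Sum>j<m. x j) i \<le> Poly_Mapping.lookup (\<Sum>j<m. b j) i"
      by (simp add: xy(1) sum.distrib lookup_add)
    also have "\<dots> \<le> Poly_Mapping.lookup (a + t) i" by (simp add: b(2) lookup_add)
    also have "\<dots> = Poly_Mapping.lookup a i" using t(1) True by (simp add: lookup_add exponents_in_iff)
    finally show ?thesis .
  next
    case False
    then show ?thesis using xy(2) by (simp add: lookup_sum exponents_in_iff)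
  qed
  then obtain q where q: "a = (\<Sum>j<m. x j) + q" using exponent_le_iff[of "\<Sum>j<m. x j" a] by blast
  \<comment> \<open>The surplus \<open>q\<close> goes to index 0, which exists as
    \<open>m > 0\<close>; each \<open>d j\<close> stays in the localised ideal, with
    \<open>y j\<close> as denominator.\<close>
  define d where "d j = x j + (if j = 0 then q else 0)" for j
  have "(\<Sum>j<m. d j) = a" using m by (simp add: d_def q sum.distrib)
  moreover have "d j \<in> V" if "j < m" for j
  proof -
    have "d j + y j = b j + (if j = 0 then q else 0)" by (simp add: d_def xy(1) add_ac)
    then have "d j + y j \<in> U" using exponent_upsetD[OF U b(1)[OF that]] by simp
    then show ?thesis using xy(3) by (auto simp: V_def)
  qed
  then have "(\<Sum>j<m. (1 / real m) *\<^sub>R real_vec (d j)) \<in> convex hull (real_vec ` V)"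
    using m by (intro convex_sum convex_convex_hull) (auto intro: hull_inc)
  ultimately show "real_vec a /\<^sub>R real m \<in> convex hull (real_vec ` exponents (loc_contract mpoly_ring P (monomial_span U)))"
    by (simp add: V flip: scaleR_sum_right real_vec_sum) (simp add: divide_inverse)
qed

text \<open>A real infimum is a lower bound only for a set bounded below. The bound 0 comes from the
  positive orthant, and it takes a maximal associated prime to put the polyhedron there: an
  intersection over no primes would be the whole space.\<close>

lemma polyhedron_alpha_le:
  fixes U :: "('v::finite \<Rightarrow>\<^sub>0 nat) set" and x :: "real ^ 'v"
  assumes "exponent_upset U" "U \<noteq> UNIV"
    and "x \<in> symbolic_polyhedron (monomial_span U :: ('v, 'k::field) mpoly set)"
  shows "polyhedron_alpha (symbolic_polyhedron (monomial_span U :: ('v, 'k::field) mpoly set)) \<le> (\<Sum>i\<in>UNIV. x $ i)"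
  unfolding polyhedron_alpha_def
proof (rule cINF_lower[OF _ assms(3)])
  let ?Q = "symbolic_polyhedron (monomial_span U :: ('v, 'k) mpoly set)"
  obtain P where P: "P \<in> maxAss mpoly_ring (monomial_span U :: ('v, 'k) mpoly set)"
    using maxAss_monomial_span_nonempty[OF assms(1,2)] by blast
  have "convex {y :: real ^ 'v. \<forall>i. y $ i \<ge> 0}" by (auto simp: convex_def)
  then have "convex hull (real_vec ` exponents (loc_contract mpoly_ring P (monomial_span U))) \<subseteq> {y. \<forall>i. y $ i \<ge> 0}"
    by (intro hull_minimal) (auto simp: real_vec_def)
  then have "?Q \<subseteq> {y. \<forall>i. y $ i \<ge> 0}" using P unfolding symbolic_polyhedron_def by blast
  then show "bdd_below ((\<lambda>y. \<Sum>i\<in>UNIV. y $ i) ` ?Q)"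
    by (intro bdd_belowI2[of _ 0]) (auto intro!: sum_nonneg)
qed

section \<open>The containment\<close>

text \<open>The monomials with exponent minimal under divisibility form an irredundant generating
  set, so equigeneration gives them a common degree. Every exponent in \<open>U\<close> lies above
  one of them by descent on the degree, which also identifies that degree with the initial
  degree.\<close>

lemma equigenerated_exponents:
  fixes U :: "('v::finite \<Rightarrow>\<^sub>0 nat) set"
  assumes U: "exponent_upset U" and eq: "equigenerated (monomial_span U :: ('v, 'k::field) mpoly set)"
    and c: "c \<in> U"
  obtains g w where "g \<in> U" "c = g + w"
    and "mon_deg g = initial_degree (monomial_span U :: ('v, 'k::field) mpoly set)"
proof -
  let ?I = "monomial_span U :: ('v, 'k) mpoly set"
  define M where "M = {g \<in> U. \<forall>h\<in>U. \<forall>w. g = h + w \<longrightarrow> h = g}"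
  have below: "\<exists>g\<in>M. \<exists>w. a = g + w" if "a \<in> U" for a
    using that
  proof (induction "mon_deg a" arbitrary: a rule: less_induct)
    case less
    show ?case
    proof (cases "a \<in> M")
      case True
      then show ?thesis by (metis add.right_neutral)
    next
      case False
      then obtain h w where h: "h \<in> U" "a = h + w" "h \<noteq> a" using less.prems by (auto simp: M_def)
      then have "w \<noteq> 0" by auto
      then have "mon_deg w > 0" using mon_deg_eq_0_iff[of w] by blast
      then have "mon_deg h < mon_deg a" by (simp add: h)
      then obtain g v where "g \<in> M" "h = g + v" using less.hyps[OF _ h(1)] by blast
      with h(2) show ?thesis by (metis add.assoc)
    qed
  qed
  have "{b + w | b w. b \<in> M} = U"
  proof (intro equalityI subsetI)
    show "a \<in> U" if "a \<in> {b + w | b w. b \<in> M}" for a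
      using that exponent_upsetD[OF U] by (auto simp: M_def)
    show "a \<in> {b + w | b w. b \<in> M}" if "a \<in> U" for a
      using below[OF that] by blast
  qed
  then have gen: "genideal mpoly_ring (mon ` M) = ?I" by (simp only: genideal_mon)
  have "genideal mpoly_ring (mon ` M - {mon g}) \<noteq> ?I" if g: "g \<in> M" for g
  proof
    assume *: "genideal mpoly_ring (mon ` M - {mon g}) = ?I"
    have "mon ` M - {mon g} = (mon ` (M - {g}) :: ('v, 'k) mpoly set)"
      by (auto simp: mon_def) (metis keys_mon mon_def singleton_inject)
    with * have I: "?I = monomial_span {b + w | b w. b \<in> M - {g}}" by (simp only: genideal_mon)
    have "mon g \<in> ?I" using g by (simp add: M_def)
    then have "mon g \<in> (monomial_span {b + w | b w. b \<in> M - {g}} :: ('v, 'k) mpoly set)"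
      by (simp only: I)
    then obtain b w where "g = b + w" "b \<in> M" "b \<noteq> g" by auto
    then show False using g by (auto simp: M_def)
  qed
  then have min: "minimal_generators ?I (mon ` M)"
    unfolding minimal_generators_def using gen by (auto simp: homogeneous_def)
  obtain d where d: "\<And>G g. minimal_generators ?I G \<Longrightarrow> g \<in> G \<Longrightarrow> homogeneous d g"
    using eq unfolding equigenerated_def by blast
  have deg: "mon_deg g = d" if "g \<in> M" for g
    using d[OF min, of "mon g"] that by (simp add: homogeneous_def)
  obtain g w where gw: "g \<in> M" "c = g + w" using below[OF c] by blast
  have "initial_degree ?I = d"
    unfolding initial_degree_def
  proof (rule Least_equality)
    have "mon g \<in> ?I" using gw by (simp add: M_def)
    moreover have "(mon g :: ('v, 'k) mpoly) \<noteq> 0" using keys_mon[of g] by (metis keys_zero insert_not_empty)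
    ultimately show "\<exists>f\<in>?I. f \<noteq> 0 \<and> homogeneous d f"
      using deg[OF gw(1)] by (auto simp: homogeneous_def intro!: bexI[of _ "mon g"])
  next
    fix k assume "\<exists>f\<in>?I. f \<noteq> 0 \<and> homogeneous k f"
    then obtain f :: "('v, 'k) mpoly" where f: "f \<in> ?I" "f \<noteq> 0" "homogeneous k f" by blast
    then obtain a where a: "a \<in> Poly_Mapping.keys f" using poly_mapping_eqI[of f 0] by (force simp: in_keys_iff)
    then have "a \<in> U" "mon_deg a = k" using f by (auto simp: monomial_span_def homogeneous_def)
    moreover from this obtain h v where "h \<in> M" "a = h + v" using below by blast
    ultimately show "d \<le> k" using deg by auto
  qed
  then show ?thesis using that[of g w] gw deg by (auto simp: M_def)
qed

theorem proposition6p7: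
  fixes I :: "('v::finite, 'k::field) mpoly set" and e :: nat
  assumes "monomial_ideal I"
    and "I \<noteq> {0}"
    and "I \<noteq> UNIV"
    and "equigenerated I"
    and "big_height mpoly_ring I = enat e"
    and "polyhedron_alpha (symbolic_polyhedron I)
           \<ge> (real (initial_degree I) + real e - 1) / real e"
  shows "\<forall>r::nat. r > 0 \<longrightarrow>
           symbolic_power mpoly_ring I (e * r)
             \<subseteq> ideal_prod mpoly_ring (ideal_pow mpoly_ring max_ideal ((e - 1) * r))
                                    (ideal_pow mpoly_ring I r)"
proof (intro allI impI subsetI)
  fix r :: nat and f :: "('v, 'k) mpoly"
  assume r: "r > 0" and f: "f \<in> symbolic_power mpoly_ring I (e * r)"
  define U where "U = exponents I"
  have I: "I = monomial_span U" and U: "exponent_upset U"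
    using monomial_ideal_eq_span[OF assms(1)] by (simp_all add: U_def)
  have "U \<noteq> {}"
  proof
    assume "U = {}"
    then have "I = {0}" by (auto simp: I monomial_span_def keys_eq_empty)
    with assms(2) show False by simp
  qed
  have "U \<noteq> UNIV" using assms(3) by (auto simp: I monomial_span_def)
  have quot: "exponent_of (\<lambda>i. Poly_Mapping.lookup a i div r) \<in> U" if "a \<in> Poly_Mapping.keys f" for a
    using floor_quotient_mem_of_symbolic_power[OF U \<open>U \<noteq> {}\<close> _ r _ that] assms(5) f by (simp add: I)
  define d where "d = initial_degree I"
  obtain c where "c \<notin> U" using \<open>U \<noteq> UNIV\<close> by blast
  then obtain S where "(variable_prime S :: ('v, 'k) mpoly set) \<in> Ass mpoly_ring (monomial_span U)"
    and "S \<noteq> {}" "card S \<le> e"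
    using exists_small_associated_variable_prime[OF U \<open>U \<noteq> {}\<close> _ assms(5)[unfolded I]] by blast
  \<comment> \<open>A nonempty \<open>S\<close> with at most \<open>e\<close> elements rules out
    \<open>e = 0\<close>, for which the quotients by \<open>e\<close> in the hypothesis would be 0
    by convention.\<close>
  then have e: "e > 0" by (metis card_eq_0_iff finite gr0I le_zero_eq)
  have "a \<in> {b + c | b c. b \<in> sumset_pow (- {0}) ((e - 1) * r) \<and> c \<in> sumset_pow U r}"
    if a: "a \<in> Poly_Mapping.keys f" for a
  proof -
    let ?c = "exponent_of (\<lambda>i. Poly_Mapping.lookup a i div r)"
    obtain g w where g: "g \<in> U" "?c = g + w" "mon_deg g = d"
      using equigenerated_exponents[OF U _ quot[OF a], where 'k = 'k] assms(4) unfolding d_def I by blast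
    \<comment> \<open>The generator \<open>g\<close> divides the floor monomial, so \<open>r\<close>
      times \<open>g\<close> is at most \<open>a\<close>.\<close>
    have "Poly_Mapping.lookup (\<Sum>j<r. g) i \<le> Poly_Mapping.lookup a i" for i
    proof -
      have "Poly_Mapping.lookup g i \<le> Poly_Mapping.lookup ?c i" by (simp only: g(2) lookup_add le_add1)
      then show ?thesis using r by (simp add: lookup_sum less_eq_div_iff_mult_less_eq mult.commute)
    qed
    then obtain u where u: "a = (\<Sum>j<r. g) + u" using exponent_le_iff[of "\<Sum>j<r. g" a] by blast
    have deg_g: "mon_deg (\<Sum>j<r. g) = r * d"
      using g(3) by (simp add: mon_deg_def lookup_sum flip: sum_distrib_left)
    have "real_vec a /\<^sub>R real (e * r) \<in> symbolic_polyhedron I"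
      using real_vec_quotient_mem_symbolic_polyhedron[OF U _ _ a, of "e * r"] f e r by (simp add: I)
    then have "polyhedron_alpha (symbolic_polyhedron I) \<le> (\<Sum>i\<in>UNIV. (real_vec a /\<^sub>R real (e * r)) $ i)"
      unfolding I by (rule polyhedron_alpha_le[OF U \<open>U \<noteq> UNIV\<close>])
    also have "\<dots> = real (mon_deg a) / real (e * r)"
      by (simp add: real_vec_def mon_deg_def divide_inverse mult.commute sum_distrib_left)
    finally have "(real d + real e - 1) / real e \<le> real (mon_deg a) / real (e * r)"
      using assms(6) unfolding d_def by linarith
    then have "(real d + real e - 1) * real r \<le> real (mon_deg a)"
      using e r by (simp add: field_simps)
    \<comment> \<open>Since \<open>e > 0\<close>, the truncated difference \<open>e - 1\<close>
      agrees with the real one.\<close>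
    moreover have "real d + real e - 1 = real (d + (e - 1))" using e by simp
    ultimately have "real ((d + (e - 1)) * r) \<le> real (mon_deg a)" by (metis of_nat_mult)
    then have "(d + (e - 1)) * r \<le> mon_deg a" using of_nat_le_iff by blast
    \<comment> \<open>Removing \<open>r\<close> copies of \<open>g\<close>, of total degree
      \<open>r * d\<close>, leaves exactly the degree needed for the power of the maximal
      ideal.\<close>
    then have "(e - 1) * r \<le> mon_deg u"
      using deg_g by (simp add: u algebra_simps)
    then have "u \<in> sumset_pow (- {0}) ((e - 1) * r)" by (rule sumset_pow_nonzero)
    moreover have "(\<Sum>j<r. g) \<in> sumset_pow U r" using sumset_pow_multiple[OF g(1), of 0 r] by simp
    ultimately show ?thesis using u by (auto simp: add.commute)
  qed
  then have "f \<in> monomial_span {b + c | b c. b \<in> sumset_pow (- {0}) ((e - 1) * r) \<and> c \<in> sumset_pow U r}"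
    unfolding monomial_span_def by blast
  then show "f \<in> ideal_prod mpoly_ring (ideal_pow mpoly_ring max_ideal ((e - 1) * r)) (ideal_pow mpoly_ring I r)"
    unfolding I max_ideal_eq_span ideal_pow_monomial_span[OF U] ideal_pow_monomial_span[OF exponent_upset_nonzero]
      ideal_prod_monomial_span[OF exponent_upset_sumset_pow[OF exponent_upset_nonzero] exponent_upset_sumset_pow[OF U]] .
qed

end
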